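(* Let $p>0$. Suppose that $V,W\subseteq\mathbb{C}$ are domains with nonempty intersection, neither of which is contained in the other, and that $E[T_V^p]<\infty$ and $E[T_W^p]<\infty$. Let $\partial V^+=\partial V\cap W$ and $\partial W^+=\partial W\cap V$, and assume that the following conditions are satisfied: (i) $\sup_{a\in\partial V^+}E_a[T_W^p]<\infty$; (ii) $\sup_{a\in\partial W^+}E_a[T_V^p]<\infty$; (iii) $\sup_{a\in\partial V^+}P_a(B_{T_W}\in\partial W^+)<1$. Then $E[T_{V\cup W}^p]<\infty$.
   Context: A domain is a nonempty connected open subset of $\mathbb{C}$. $B_t$ denotes a standard planar Brownian motion, and $E_a$, $P_a$ denote expectation and probability given $B_0=a$ a.s. For a domain $U$, $T_U=\inf\{t\ge 0: B_t\notin U\}$ is the first exit time from $U$. For $p>0$, finiteness of $E_a[T_U^p]$ for one $a\in U$ implies finiteness for all $a\in U$, and in this case one writes $E[T_U^p]<\infty$. $\partial U$ denotes the boundary of $U$ in $\mathbb{C}$ (the point at $\infty$ is not included). *)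

theory Defs
  imports "HOL-Probability.Probability"
begin

text \<open>
  Planar Brownian motion on \<^term>\<open>M\<close> with \<^term>\<open>B 0 = a\<close> almost surely. Time is the half-line
  \<^term>\<open>{0..}\<close> inside \<^typ>\<open>real\<close>; values of \<^term>\<open>B\<close> at negative times are irrelevant.
  Every path (not merely almost every path) is continuous, so that the exit times and the exit
  events below are measurable without completing \<^term>\<open>M\<close>.
\<close>

definition planar_brownian_motion ::
    "'w measure \<Rightarrow> (real \<Rightarrow> 'w \<Rightarrow> complex) \<Rightarrow> complex \<Rightarrow> bool" where
  "planar_brownian_motion M B a \<longleftrightarrow>
     prob_space M \<and>
     (\<forall>t\<ge>0. B t \<in> borel_measurable M) \<and>
     (AE \<omega> in M. B 0 \<omega> = a) \<and>
     (\<forall>\<omega>\<in>space M. continuous_on {0..} (\<lambda>t. B t \<omega>)) \<and>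
     (\<forall>s t. 0 \<le> s \<and> s < t \<longrightarrow>
        distributed M lborel (\<lambda>\<omega>. B t \<omega> - B s \<omega>)
          (\<lambda>z. ennreal (normal_density 0 (sqrt (t - s)) (Re z) *
                        normal_density 0 (sqrt (t - s)) (Im z)))) \<and>
     (\<forall>(\<tau> :: nat \<Rightarrow> real) n. 0 \<le> \<tau> 0 \<and> incseq \<tau> \<longrightarrow>
        prob_space.indep_vars M (\<lambda>_. borel)
          (\<lambda>i \<omega>. B (\<tau> (Suc i)) \<omega> - B (\<tau> i) \<omega>) {..<n})"

definition domain :: "complex set \<Rightarrow> bool" where
  "domain U \<longleftrightarrow> open U \<and> connected U \<and> U \<noteq> {}"

text \<open>The first exit time of a path; it is \<^term>\<open>\<infinity> :: ennreal\<close> if the path never leaves \<^term>\<open>U\<close>.\<close>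

definition exit_time :: "complex set \<Rightarrow> (real \<Rightarrow> complex) \<Rightarrow> ennreal" where
  "exit_time U x = Inf {ennreal t |t. 0 \<le> t \<and> x t \<notin> U}"

definition ennreal_powr :: "ennreal \<Rightarrow> real \<Rightarrow> ennreal" where
  "ennreal_powr x p = (if x = \<infinity> then \<infinity> else ennreal (enn2real x powr p))"

text \<open>
  In the following \<^term>\<open>P a\<close> is the law under which \<^term>\<open>B\<close> is started at \<^term>\<open>a\<close>.
\<close>

definition exit_moment ::
    "(complex \<Rightarrow> 'w measure) \<Rightarrow> (real \<Rightarrow> 'w \<Rightarrow> complex) \<Rightarrow> real \<Rightarrow> complex set \<Rightarrow> complex \<Rightarrow> ennreal" where
  "exit_moment P B p U a = (\<integral>\<^sup>+ \<omega>. ennreal_powr (exit_time U (\<lambda>t. B t \<omega>)) p \<partial>P a)"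

text \<open>
  Finiteness of the exit moment does not depend on the starting point in the domain \<^term>\<open>U\<close>;
  the definition asks for it at every starting point.
\<close>

definition finite_exit_moment ::
    "(complex \<Rightarrow> 'w measure) \<Rightarrow> (real \<Rightarrow> 'w \<Rightarrow> complex) \<Rightarrow> real \<Rightarrow> complex set \<Rightarrow> bool" where
  "finite_exit_moment P B p U \<longleftrightarrow> (\<forall>a\<in>U. exit_moment P B p U a < \<infinity>)"

text \<open>
  The probability that \<^term>\<open>B\<close>, started at \<^term>\<open>a\<close>, leaves \<^term>\<open>U\<close> in finite time through \<^term>\<open>S\<close>.
\<close>

definition exit_prob ::
    "(complex \<Rightarrow> 'w measure) \<Rightarrow> (real \<Rightarrow> 'w \<Rightarrow> complex) \<Rightarrow> complex set \<Rightarrow> complex set \<Rightarrow> complex \<Rightarrow> ennreal" where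
  "exit_prob P B U S a =
     emeasure (P a) {\<omega> \<in> space (P a). exit_time U (\<lambda>t. B t \<omega>) < \<infinity> \<and>
                       B (enn2real (exit_time U (\<lambda>t. B t \<omega>))) \<omega> \<in> S}"

end

theory Submission
  imports Defs
begin

text \<open>
  Let \<open>m K a\<close> be the \<open>p\<close>-th moment of \<open>min K T\<close> for the exit time \<open>T\<close> of \<open>V \<union> W\<close>, started at \<open>a\<close>, and
  let \<open>x\<close>, \<open>y\<close> be its suprema over the parts of the boundary of \<open>V\<close> inside \<open>W\<close> and of \<open>W\<close> inside \<open>V\<close>.
  Since \<open>(s + t)\<^sup>p \<le> C s\<^sup>p + l t\<^sup>p\<close> with \<open>l > 1\<close> as close to 1 as desired, one application of the
  strong Markov property at the exit from \<open>W\<close>, respectively \<open>V\<close>, gives \<open>x \<le> \<alpha> + l \<theta> y\<close> and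
  \<open>y \<le> \<beta> + l x\<close>, where \<open>\<theta> < 1\<close> is the supremum in (iii) and \<open>\<alpha>\<close>, \<open>\<beta>\<close> do not depend on \<open>K\<close>. The
  truncation makes \<open>x\<close> and \<open>y\<close> finite, so \<open>x \<le> (\<alpha> + l \<theta> \<beta>) / (1 - l\<^sup>2 \<theta>)\<close> uniformly in \<open>K\<close>.

  The strong Markov property is proved by approximating the exit time from above by dyadic times.
  Continuous paths are represented by their values at dyadic times, so that past and future of
  the motion are random elements of a countable product space.
\<close>

section \<open>Independence of past and future\<close>

text \<open>A code records its grid level, and every dyadic number has codes on all finer grids.
  Finitely many dyadic times can therefore be read on one common grid, as in
  \<open>dyadic_refine\<close>.\<close>

definition dyadic :: "nat \<times> nat \<Rightarrow> real" where
  "dyadic i = real (fst i) / 2 ^ snd i"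

abbreviation path_space :: "(nat \<times> nat \<Rightarrow> complex) measure" where
  "path_space \<equiv> (\<Pi>\<^sub>M i\<in>UNIV. borel)"

text \<open>The path stopped at \<open>t\<close> is sampled at all dyadic times, so the target space
  does not vary with \<open>t\<close>. Subtracting \<open>B 0\<close> leaves a function of
  increments alone, and independence is assumed for increments.\<close>

definition past :: "(real \<Rightarrow> 'w \<Rightarrow> complex) \<Rightarrow> real \<Rightarrow> 'w \<Rightarrow> nat \<times> nat \<Rightarrow> complex" where
  "past B t \<omega> = (\<lambda>i. B (min t (dyadic i)) \<omega> - B 0 \<omega>)"

definition future :: "(real \<Rightarrow> 'w \<Rightarrow> complex) \<Rightarrow> real \<Rightarrow> 'w \<Rightarrow> nat \<times> nat \<Rightarrow> complex" where
  "future B t \<omega> = (\<lambda>i. B (t + dyadic i) \<omega> - B t \<omega>)"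

definition grid_increment :: "(real \<Rightarrow> 'w \<Rightarrow> complex) \<Rightarrow> nat \<Rightarrow> nat \<Rightarrow> 'w \<Rightarrow> complex" where
  "grid_increment B L i \<omega> = B (real (Suc i) / 2 ^ L) \<omega> - B (real i / 2 ^ L) \<omega>"

lemma dyadic_nonneg [simp]: "0 \<le> dyadic i"
  by (simp add: dyadic_def)

lemma dyadic_refine:
  assumes "n \<le> L"
  shows "dyadic (k, n) = real (k * 2 ^ (L - n)) / 2 ^ L"
  using assms by (simp add: dyadic_def field_simps flip: power_add)

lemma sum_grid_increment:
  "(\<Sum>i<c. grid_increment B L (m + i) \<omega>) = B (real (m + c) / 2 ^ L) \<omega> - B (real m / 2 ^ L) \<omega>"
  unfolding grid_increment_def
  using sum_lessThan_telescope[of "\<lambda>i. B (real (m + i) / 2 ^ L) \<omega>" c] by simp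

section \<open>Increments along a dyadic grid\<close>

locale planar_bm =
  fixes M :: "'w measure" and B :: "real \<Rightarrow> 'w \<Rightarrow> complex" and a :: complex
  assumes brownian: "planar_brownian_motion M B a"

sublocale planar_bm \<subseteq> prob_space M
  using brownian by (simp add: planar_brownian_motion_def)

context planar_bm
begin

lemma measurable_B: "0 \<le> t \<Longrightarrow> B t \<in> borel_measurable M"
  using brownian by (simp add: planar_brownian_motion_def)

lemma AE_start: "AE \<omega> in M. B 0 \<omega> = a"
  using brownian by (simp add: planar_brownian_motion_def)

lemma continuous_B: "\<omega> \<in> space M \<Longrightarrow> continuous_on {0..} (\<lambda>t. B t \<omega>)"
  using brownian by (simp add: planar_brownian_motion_def)

lemma distr_increment:
  assumes "0 \<le> s" "s < t"
  shows "distr M borel (\<lambda>\<omega>. B t \<omega> - B s \<omega>) =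
    density lborel (\<lambda>z. ennreal (normal_density 0 (sqrt (t - s)) (Re z) *
                                 normal_density 0 (sqrt (t - s)) (Im z)))"
proof -
  have "distributed M lborel (\<lambda>\<omega>. B t \<omega> - B s \<omega>)
      (\<lambda>z. ennreal (normal_density 0 (sqrt (t - s)) (Re z) *
                    normal_density 0 (sqrt (t - s)) (Im z)))"
    using brownian assms by (simp add: planar_brownian_motion_def)
  from distributed_distr_eq_density[OF this] show ?thesis
    by (simp cong: distr_cong)
qed

lemma measurable_grid_increment: "grid_increment B L i \<in> borel_measurable M"
  unfolding grid_increment_def by (intro borel_measurable_diff measurable_B) auto

text \<open>Independence of an infinite family concerns only its finite subfamilies, and each of
  these lies in some \<open>{..<n}\<close>, where the definition of Brownian motion applies to the
  times \<open>(m + i) / 2 ^ L\<close>.\<close>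

lemma indep_grid_increment_shift: "indep_vars (\<lambda>_. borel) (\<lambda>i. grid_increment B L (m + i)) UNIV"
proof -
  let ?X = "\<lambda>i. grid_increment B L (m + i)"
  have fin: "indep_vars (\<lambda>_. borel) ?X {..<n}" for n
  proof -
    have "incseq (\<lambda>i. real (m + i) / 2 ^ L)"
      by (intro incseq_SucI) (simp add: divide_right_mono)
    moreover have "\<forall>\<tau> n. 0 \<le> \<tau> 0 \<and> incseq \<tau> \<longrightarrow>
        indep_vars (\<lambda>_. borel) (\<lambda>i \<omega>. B (\<tau> (Suc i)) \<omega> - B (\<tau> i) \<omega>) {..<n}"
      using brownian unfolding planar_brownian_motion_def by (elim conjE)
    from this[rule_format, of "\<lambda>i. real (m + i) / 2 ^ L" n] calculation have "indep_vars (\<lambda>_. borel)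
        (\<lambda>i \<omega>. B (real (m + Suc i) / 2 ^ L) \<omega> - B (real (m + i) / 2 ^ L) \<omega>) {..<n}"
      by simp
    then show ?thesis
      by (simp add: grid_increment_def[abs_def])
  qed
  show ?thesis
    unfolding indep_vars_def2
  proof (intro conjI ballI measurable_grid_increment)
    show "indep_sets (\<lambda>i. {?X i -` A \<inter> space M |A. A \<in> sets borel}) UNIV"
    proof (subst indep_sets_finite_index_sets, intro allI impI)
      fix J :: "nat set" assume "finite J"
      then obtain n where "J \<subseteq> {..<n}"
        using finite_nat_iff_bounded by blast
      moreover have "indep_sets (\<lambda>i. {?X i -` A \<inter> space M |A. A \<in> sets borel}) {..<n}"
        using fin[of n] unfolding indep_vars_def2 by (elim conjE)
      ultimately show "indep_sets (\<lambda>i. {?X i -` A \<inter> space M |A. A \<in> sets borel}) J"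
        by (rule indep_sets_mono_index)
    qed
  qed
qed

lemma indep_grid_increment: "indep_vars (\<lambda>_. borel) (grid_increment B L) UNIV"
  using indep_grid_increment_shift[of L 0] by simp

text \<open>The right-hand side involves neither \<open>m\<close>, nor the start, nor the
  probability space: this is the stationarity that later allows the motion to be restarted.\<close>

lemma distr_grid_increments:
  "distr M (\<Pi>\<^sub>M i\<in>UNIV. borel) (\<lambda>\<omega> i. grid_increment B L (m + i) \<omega>) =
   (\<Pi>\<^sub>M i\<in>(UNIV :: nat set). density lborel (\<lambda>z. ennreal (normal_density 0 (sqrt (1 / 2 ^ L)) (Re z) *
                                 normal_density 0 (sqrt (1 / 2 ^ L)) (Im z))))"
proof -
  have "distr M (\<Pi>\<^sub>M i\<in>UNIV. borel) (\<lambda>\<omega>. \<lambda>i\<in>UNIV. grid_increment B L (m + i) \<omega>) =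
      (\<Pi>\<^sub>M i\<in>UNIV. distr M borel (grid_increment B L (m + i)))"
    using indep_grid_increment_shift[of L m]
    by (subst (asm) indep_vars_iff_distr_eq_PiM) (auto intro: measurable_grid_increment)
  also have "\<dots> = (\<Pi>\<^sub>M i\<in>(UNIV :: nat set). density lborel (\<lambda>z. ennreal (normal_density 0 (sqrt (1 / 2 ^ L)) (Re z) *
                                 normal_density 0 (sqrt (1 / 2 ^ L)) (Im z))))"
  proof (rule PiM_cong[OF refl])
    fix i :: nat
    show "distr M borel (grid_increment B L (m + i)) =
      density lborel (\<lambda>z. ennreal (normal_density 0 (sqrt (1 / 2 ^ L)) (Re z) *
                                 normal_density 0 (sqrt (1 / 2 ^ L)) (Im z)))"
      unfolding grid_increment_def[abs_def]
      by (subst distr_increment) (auto simp: divide_strict_right_mono simp flip: diff_divide_distrib)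
  qed
  finally show ?thesis by (simp add: restrict_def)
qed

section \<open>Past and future as functions of the grid increments\<close>

lemma measurable_future: "0 \<le> t \<Longrightarrow> future B t \<in> measurable M path_space"
  unfolding future_def[abs_def]
  by (rule measurable_PiM_single') (auto intro!: borel_measurable_diff measurable_B)

lemma measurable_past: "0 \<le> t \<Longrightarrow> past B t \<in> measurable M path_space"
  unfolding past_def[abs_def]
  by (rule measurable_PiM_single') (auto intro!: borel_measurable_diff measurable_B)

lemma future_eq_grid:
  assumes "n \<le> L" "snd i \<le> L"
  shows "future B (dyadic (j, n)) \<omega> i =
    (\<Sum>l<fst i * 2 ^ (L - snd i). grid_increment B L (j * 2 ^ (L - n) + l) \<omega>)"
  using dyadic_refine[OF assms(1), of j] dyadic_refine[OF assms(2), of "fst i"]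
  unfolding sum_grid_increment future_def by (simp add: add_divide_distrib)

lemma past_eq_grid:
  assumes "n \<le> L" "snd i \<le> L"
  shows "past B (dyadic (j, n)) \<omega> i =
    (\<Sum>l<min (j * 2 ^ (L - n)) (fst i * 2 ^ (L - snd i)). grid_increment B L l \<omega>)"
proof -
  have "min (dyadic (j, n)) (dyadic i) =
      real (min (j * 2 ^ (L - n)) (fst i * 2 ^ (L - snd i))) / 2 ^ L"
    using dyadic_refine[OF assms(1), of j] dyadic_refine[OF assms(2), of "fst i"]
    by (simp add: min_divide_distrib_right of_nat_min)
  then show ?thesis
    using sum_grid_increment[of B L 0 \<omega>] unfolding past_def by simp
qed

text \<open>Events that constrain finitely many coordinates form an intersection-stable generator,
  so independence may be checked on them. There all times involved lie on one grid, and past and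
  future depend on disjoint blocks of its independent increments.\<close>

lemma indep_past_future:
  "indep_var path_space (past B (dyadic (j, n))) path_space (future B (dyadic (j, n)))"
proof -
  let ?t = "dyadic (j, n)"
  define E where "E f = {f -` {y. \<forall>i\<in>J. y i \<in> A i} \<inter> space M |J A.
      finite J \<and> (\<forall>i. A i \<in> sets (borel :: complex measure))}"
    for f :: "'w \<Rightarrow> nat \<times> nat \<Rightarrow> complex"
  have cyl: "{y. \<forall>i\<in>J. y i \<in> A i} \<in> sets path_space"
    if "finite J" "\<forall>i. A i \<in> sets borel" for J and A :: "nat \<times> nat \<Rightarrow> complex set"
  proof -
    have "{y \<in> space path_space. \<forall>i\<in>J. y i \<in> A i} \<in> sets path_space"
      using that by measurable
    then show ?thesis by (simp add: space_PiM)
  qed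
  have stable: "Int_stable (E f)" for f
  proof (rule Int_stableI)
    fix a b assume "a \<in> E f" "b \<in> E f"
    then obtain J A J' A' where *: "a = f -` {y. \<forall>i\<in>J. y i \<in> A i} \<inter> space M"
      "b = f -` {y. \<forall>i\<in>J'. y i \<in> A' i} \<inter> space M" "finite J" "finite J'"
      "\<forall>i. A i \<in> sets borel" "\<forall>i. A' i \<in> sets borel"
      unfolding E_def by blast
    \<comment> \<open>Coordinates that one of the two events leaves free are padded with
      \<open>UNIV\<close>.\<close>
    let ?A = "\<lambda>i. (if i \<in> J then A i else UNIV) \<inter> (if i \<in> J' then A' i else UNIV)"
    have "a \<inter> b = f -` {y. \<forall>i\<in>J \<union> J'. y i \<in> ?A i} \<inter> space M"
      using * by (auto split: if_splits)
    then show "a \<inter> b \<in> E f"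
      unfolding E_def using * by (intro CollectI exI[of _ "J \<union> J'"] exI[of _ ?A]) auto
  qed
  \<comment> \<open>Each coordinate of \<open>f\<close> is measurable for the sigma-algebra
    generated by \<open>E f\<close>, hence so is \<open>f\<close> as a map into the product
    space.\<close>
  have sub: "sigma_sets (space M) {f -` A \<inter> space M |A. A \<in> sets path_space} \<subseteq>
      sigma_sets (space M) (E f)" for f
  proof (rule sigma_sets_mono)
    have "f \<in> measurable (sigma (space M) (E f)) path_space"
    proof (rule measurable_PiM_single')
      fix i :: "nat \<times> nat"
      show "(\<lambda>\<omega>. f \<omega> i) \<in> borel_measurable (sigma (space M) (E f))"
      proof (rule measurableI)
        fix A :: "complex set" assume "A \<in> sets borel"
        then have "(\<lambda>\<omega>. f \<omega> i) -` A \<inter> space M \<in> E f"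
          unfolding E_def by (intro CollectI exI[of _ "{i}"] exI[of _ "\<lambda>_. A"]) auto
        moreover have "E f \<subseteq> Pow (space M)" by (auto simp: E_def)
        ultimately show "(\<lambda>\<omega>. f \<omega> i) -` A \<inter> space (sigma (space M) (E f)) \<in> sets (sigma (space M) (E f))"
          by (simp add: sets_measure_of space_measure_of)
      qed auto
    qed auto
    moreover have "E f \<subseteq> Pow (space M)" by (auto simp: E_def)
    ultimately show "{f -` A \<inter> space M |A. A \<in> sets path_space} \<subseteq> sigma_sets (space M) (E f)"
      by (auto dest!: measurable_sets simp: sets_measure_of space_measure_of)
  qed
  have "indep_set (E (past B ?t)) (E (future B ?t))"
    unfolding indep_sets2_eq
  proof (intro conjI ballI)
    show "E (past B ?t) \<subseteq> events" "E (future B ?t) \<subseteq> events"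
      using measurable_sets[OF measurable_past cyl, of ?t] measurable_sets[OF measurable_future cyl, of ?t]
      by (fastforce simp: E_def)+
    fix a b assume "a \<in> E (past B ?t)" "b \<in> E (future B ?t)"
    then obtain J A J' A' where *: "a = past B ?t -` {y. \<forall>i\<in>J. y i \<in> A i} \<inter> space M"
      "b = future B ?t -` {y. \<forall>i\<in>J'. y i \<in> A' i} \<inter> space M" "finite J" "finite J'"
      "\<forall>i. A i \<in> sets borel" "\<forall>i. A' i \<in> sets borel"
      unfolding E_def by blast
    \<comment> \<open>\<open>L\<close> is to be a level at least as fine as that of the splitting
      time and of every coordinate constrained by either event.\<close>
    have "finite (insert n (snd ` (J \<union> J')))"
      using *(3,4) by simp
    then obtain L where "\<forall>l\<in>insert n (snd ` (J \<union> J')). l \<le> L"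
      unfolding finite_nat_set_iff_bounded_le by blast
    then have L: "n \<le> L" "\<And>i. i \<in> J \<Longrightarrow> snd i \<le> L" "\<And>i. i \<in> J' \<Longrightarrow> snd i \<le> L"
      by auto
    \<comment> \<open>On the grid of level \<open>L\<close> the splitting time is point number
      \<open>m\<close>; \<open>F\<close> uses only increments before it, \<open>G\<close> only
      increments from it on.\<close>
    define m where "m = j * 2 ^ (L - n)"
    define F where "F y = (\<lambda>i. \<Sum>l<min m (fst i * 2 ^ (L - snd i)). y l)"
      for y :: "nat \<Rightarrow> complex" and i :: "nat \<times> nat"
    define G where "G y = (\<lambda>i. \<Sum>l<fst i * 2 ^ (L - snd i). y (m + l))"
      for y :: "nat \<Rightarrow> complex" and i :: "nat \<times> nat"
    define R where "R I = (\<lambda>\<omega>. restrict (\<lambda>i. grid_increment B L i \<omega>) I)" for I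
    have "F \<in> measurable (\<Pi>\<^sub>M i\<in>{..<m}. borel) path_space"
      "G \<in> measurable (\<Pi>\<^sub>M i\<in>{m..}. borel) path_space"
      unfolding F_def[abs_def] G_def[abs_def]
      by (auto intro!: measurable_PiM_single' borel_measurable_sum measurable_component_singleton)
    moreover have "indep_var (\<Pi>\<^sub>M i\<in>{..<m}. borel) (R {..<m}) (\<Pi>\<^sub>M i\<in>{m..}. borel) (R {m..})"
      unfolding R_def by (rule indep_var_restrict[OF indep_grid_increment]) auto
    ultimately have ind: "indep_var path_space (F \<circ> R {..<m}) path_space (G \<circ> R {m..})"
      by (intro indep_var_compose)
    have "a = (F \<circ> R {..<m}) -` {y. \<forall>i\<in>J. y i \<in> A i} \<inter> space M"
      unfolding * using L(1,2) past_eq_grid[of n L _ j]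
      by (auto simp: F_def R_def m_def)
    moreover have "b = (G \<circ> R {m..}) -` {y. \<forall>i\<in>J'. y i \<in> A' i} \<inter> space M"
      unfolding * using L(1,3) future_eq_grid[of n L _ j]
      by (auto simp: G_def R_def m_def)
    moreover have "a \<inter> b = (\<lambda>\<omega>. ((F \<circ> R {..<m}) \<omega>, (G \<circ> R {m..}) \<omega>)) -`
        ({y. \<forall>i\<in>J. y i \<in> A i} \<times> {y. \<forall>i\<in>J'. y i \<in> A' i}) \<inter> space M"
      using calculation by auto
    ultimately show "prob (a \<inter> b) = prob a * prob b"
      using indep_varD[OF ind cyl[of J A] cyl[of J' A']] *(3-6) by simp
  qed
  then have "indep_set (sigma_sets (space M) (E (past B ?t))) (sigma_sets (space M) (E (future B ?t)))"
    by (intro indep_set_sigma_sets stable)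
  then have "indep_set
      (sigma_sets (space M) {past B ?t -` A \<inter> space M |A. A \<in> sets path_space})
      (sigma_sets (space M) {future B ?t -` A \<inter> space M |A. A \<in> sets path_space})"
    using sub[of "past B ?t"] sub[of "future B ?t"] unfolding indep_sets2_eq by blast
  then show ?thesis
    by (simp add: indep_var_eq measurable_past measurable_future)
qed

end

text \<open>A law on the product space is determined by finitely many coordinates. On a grid common
  to both times these are sums of increments, whose joint law is the same for both motions by
  \<open>distr_grid_increments\<close>.\<close>

lemma distr_future_eq:
  assumes "planar_brownian_motion M B a" "planar_brownian_motion M' B' a'"
  shows "distr M path_space (future B (dyadic i)) = distr M' path_space (future B' (dyadic i'))"
proof -
  interpret X: planar_bm M B a by unfold_locales fact
  interpret Y: planar_bm M' B' a' by unfold_locales fact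
  obtain j n where i: "i = (j, n)" by force
  obtain j' n' where i': "i' = (j', n')" by force
  show ?thesis
  proof (rule measure_eqI_PiM_infinite[where I = UNIV and M = "\<lambda>_. borel"])
    show "finite_measure (distr M path_space (future B (dyadic i)))"
      by (intro X.finite_measure_distr X.measurable_future) simp
    fix A :: "nat \<times> nat \<Rightarrow> complex set" and J assume J: "finite J" and A: "\<And>i. i \<in> J \<Longrightarrow> A i \<in> sets borel"
    have "finite ({n, n'} \<union> snd ` J)"
      using J by simp
    then obtain L where "\<forall>l\<in>{n, n'} \<union> snd ` J. l \<le> L"
      unfolding finite_nat_set_iff_bounded_le by blast
    then have L: "n \<le> L" "n' \<le> L" "\<And>i. i \<in> J \<Longrightarrow> snd i \<le> L"
      by auto
    define m where "m = j * 2 ^ (L - n)"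
    define m' where "m' = j' * 2 ^ (L - n')"
    let ?C = "{y \<in> space (\<Pi>\<^sub>M i\<in>(UNIV :: nat set). borel). \<forall>i\<in>J. (\<Sum>l<fst i * 2 ^ (L - snd i). y l) \<in> A i}"
    let ?E = "prod_emb UNIV (\<lambda>_. borel) J (Pi\<^sub>E J A)"
    have C: "?C \<in> sets (\<Pi>\<^sub>M i\<in>UNIV. borel)"
      using J A by (intro sets.sets_Collect_finite_All measurable_sets_Collect[where P = "\<lambda>x. x \<in> _" and M = borel]) auto
    have E: "?E \<in> sets path_space"
      using J A by (intro sets_PiM_I) auto
    have Ed: "?E = {y. \<forall>i\<in>J. y i \<in> A i}"
      by (auto simp: prod_emb_def PiE_def Pi_def)
    have "emeasure (distr M path_space (future B (dyadic i))) ?E =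
        emeasure M ((\<lambda>\<omega> i. grid_increment B L (m + i) \<omega>) -` ?C \<inter> space M)"
      using E L
      by (subst emeasure_distr) (auto simp: Ed i m_def X.future_eq_grid space_PiM X.measurable_future
          intro!: arg_cong[where f = "emeasure M"])
    also have "\<dots> = emeasure (distr M (\<Pi>\<^sub>M i\<in>UNIV. borel) (\<lambda>\<omega> i. grid_increment B L (m + i) \<omega>)) ?C"
      using C by (intro emeasure_distr[symmetric] measurable_PiM_single' X.measurable_grid_increment) auto
    also have "\<dots> = emeasure (distr M' (\<Pi>\<^sub>M i\<in>UNIV. borel) (\<lambda>\<omega> i. grid_increment B' L (m' + i) \<omega>)) ?C"
      by (simp add: X.distr_grid_increments Y.distr_grid_increments)
    also have "\<dots> = emeasure M' ((\<lambda>\<omega> i. grid_increment B' L (m' + i) \<omega>) -` ?C \<inter> space M')"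
      using C by (intro emeasure_distr measurable_PiM_single' Y.measurable_grid_increment) auto
    also have "\<dots> = emeasure (distr M' path_space (future B' (dyadic i'))) ?E"
      using E L
      by (subst emeasure_distr) (auto simp: Ed i' m'_def Y.future_eq_grid space_PiM Y.measurable_future
          intro!: arg_cong[where f = "emeasure M'"])
    finally show "emeasure (distr M path_space (future B (dyadic i))) ?E =
        emeasure (distr M' path_space (future B' (dyadic i'))) ?E" .
  qed (auto)
qed

section \<open>Exit times of continuous paths\<close>

definition sample :: "(real \<Rightarrow> complex) \<Rightarrow> nat \<times> nat \<Rightarrow> complex" where
  "sample x = (\<lambda>i. x (dyadic i))"

text \<open>Closed sets exhausting an open \<open>U\<close>. Membership in one of them at dyadic
  times passes to limits, hence to all times, whereas dyadic membership in \<open>U\<close> itself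
  would overlook a path that leaves \<open>U\<close> only at a non-dyadic time.\<close>

definition deep_interior :: "complex set \<Rightarrow> nat \<Rightarrow> complex set" where
  "deep_interior U n = {z. ball z (1 / real (Suc n)) \<subseteq> U}"

text \<open>A countable supremum, hence measurable on the whole product space, that reproduces the
  exit time on samples of continuous paths. The default 0 does not affect a supremum in
  \<open>ennreal\<close>.\<close>

definition exit_functional :: "complex set \<Rightarrow> (nat \<times> nat \<Rightarrow> complex) \<Rightarrow> ennreal" where
  "exit_functional U y = (SUP (n, j) \<in> UNIV.
     if \<forall>i. dyadic i \<le> dyadic j \<longrightarrow> y i \<in> deep_interior U n then ennreal (dyadic j) else 0)"

text \<open>The value is a code rather than a real number, so a rounded random time has a countable
  range and can serve as an index into a sampled path.\<close>

definition dyadic_floor :: "nat \<Rightarrow> real \<Rightarrow> nat \<times> nat" where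
  "dyadic_floor n s = (nat \<lfloor>2 ^ n * s\<rfloor>, n)"

definition eval_at :: "(nat \<times> nat \<Rightarrow> complex) \<Rightarrow> real \<Rightarrow> complex" where
  "eval_at y s = lim (\<lambda>n. y (dyadic_floor n s))"

lemma dyadic_floor_bounds:
  assumes "0 \<le> s"
  shows "dyadic (dyadic_floor n s) \<le> s" "s < dyadic (dyadic_floor n s) + 1 / 2 ^ n"
proof -
  have *: "real (nat \<lfloor>2 ^ n * s\<rfloor>) = of_int \<lfloor>2 ^ n * s\<rfloor>"
    using assms by simp
  show "dyadic (dyadic_floor n s) \<le> s"
    unfolding dyadic_floor_def dyadic_def fst_conv snd_conv *
    by (simp add: divide_le_eq mult.commute)
  have "2 ^ n * s < of_int \<lfloor>2 ^ n * s\<rfloor> + 1" by linarith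
  then show "s < dyadic (dyadic_floor n s) + 1 / 2 ^ n"
    unfolding dyadic_floor_def dyadic_def fst_conv snd_conv *
    by (simp add: less_divide_eq mult.commute flip: add_divide_distrib)
qed

lemma inverse_two_power_tendsto_0: "(\<lambda>n. 1 / 2 ^ n :: real) \<longlonglongrightarrow> 0"
  using LIMSEQ_power_zero[of "1 / 2 :: real"] by (simp add: power_one_over)

lemma dyadic_floor_tendsto:
  assumes "0 \<le> s"
  shows "(\<lambda>n. dyadic (dyadic_floor n s)) \<longlonglongrightarrow> s"
proof (rule tendsto_sandwich)
  show "\<forall>\<^sub>F n in sequentially. s - 1 / 2 ^ n \<le> dyadic (dyadic_floor n s)"
    using dyadic_floor_bounds(2)[OF assms] by (intro always_eventually allI) (smt (verit))
  show "(\<lambda>n. s - 1 / 2 ^ n) \<longlonglongrightarrow> s"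
    using tendsto_diff[OF tendsto_const inverse_two_power_tendsto_0, of s] by simp
qed (use dyadic_floor_bounds(1)[OF assms] in auto)

lemma dyadic_between:
  assumes "0 \<le> s" "s < t"
  obtains i where "s < dyadic i" "dyadic i < t"
proof -
  obtain n :: nat where n: "1 / 2 ^ n < (t - s) / 2"
    using order_tendstoD(2)[OF inverse_two_power_tendsto_0, of "(t - s) / 2"] assms
    by (auto simp: eventually_sequentially)
  let ?k = "dyadic_floor n s"
  have eq: "dyadic (Suc (fst ?k), n) = dyadic ?k + 1 / 2 ^ n"
    by (simp add: dyadic_def dyadic_floor_def add_divide_distrib)
  have "s < dyadic (Suc (fst ?k), n)" "dyadic (Suc (fst ?k), n) < t"
    unfolding eq using dyadic_floor_bounds[OF assms(1), of n] n assms by auto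
  then show thesis by (rule that)
qed

lemma path_tendsto:
  fixes x :: "real \<Rightarrow> complex"
  assumes "continuous_on {0..} x" "0 \<le> s" "u \<longlonglongrightarrow> s" "\<And>n. 0 \<le> u n"
  shows "(\<lambda>n. x (u n)) \<longlonglongrightarrow> x s"
  using assms by (intro continuous_on_tendsto_compose[OF assms(1)]) auto

lemma eval_at_sample:
  assumes "continuous_on {0..} x" "0 \<le> s"
  shows "eval_at (sample x) s = x s"
  unfolding eval_at_def sample_def
  by (intro limI path_tendsto dyadic_floor_tendsto assms) auto

lemma closed_deep_interior: "closed (deep_interior U n)"
proof -
  have "- deep_interior U n = (\<Union>w\<in>-U. ball w (1 / real (Suc n)))"
    unfolding deep_interior_def by (auto simp: dist_commute)
  then show ?thesis by (simp add: closed_def open_UN)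
qed

lemma deep_interior_subset: "deep_interior U n \<subseteq> U"
  unfolding deep_interior_def by (auto intro: centre_in_ball[THEN iffD2])

lemma compact_subset_deep_interior:
  assumes "open U" "compact C" "C \<subseteq> U"
  obtains n where "C \<subseteq> deep_interior U n"
proof -
  obtain e where e: "e > 0" "(\<Union>z\<in>C. ball z e) \<subseteq> U"
    using compact_subset_open_imp_ball_epsilon_subset[OF assms(2,1,3)] by metis
  obtain n where "1 / real (Suc n) < e"
    using e(1) nat_approx_posE by blast
  then have "C \<subseteq> deep_interior U n"
    using e(2) unfolding deep_interior_def by (force intro: subsetD[OF subset_ball])
  then show thesis by (rule that)
qed

lemma le_exit_time:
  assumes "\<And>s. 0 \<le> s \<Longrightarrow> s < r \<Longrightarrow> x s \<in> U"
  shows "ennreal r \<le> exit_time U x"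
  unfolding exit_time_def
proof (rule Inf_greatest, clarify)
  fix t assume "0 \<le> t" "x t \<notin> U"
  then have "r \<le> t" using assms not_le by blast
  then show "ennreal r \<le> ennreal t" by (rule ennreal_leI)
qed

lemma exit_time_le: "0 \<le> s \<Longrightarrow> x s \<notin> U \<Longrightarrow> exit_time U x \<le> ennreal s"
  unfolding exit_time_def by (auto intro!: Inf_lower)

lemma in_before_exit_time:
  assumes "ennreal r \<le> exit_time U x" "0 \<le> s" "s < r"
  shows "x s \<in> U"
  using exit_time_le[of s x U] assms by (metis ennreal_less_iff leD order_less_le_trans)

text \<open>A path still in the open set \<open>U\<close> at its exit time would by continuity
  remain there a little longer, which contradicts the infimum.\<close>

lemma exit_time_attained:
  assumes U: "open U" and x: "continuous_on {0..} x" and fin: "exit_time U x < \<infinity>"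
  shows "x (enn2real (exit_time U x)) \<notin> U"
proof
  define s where "s = enn2real (exit_time U x)"
  have s: "exit_time U x = ennreal s" "0 \<le> s"
    using fin by (auto simp: s_def)
  assume "x (enn2real (exit_time U x)) \<in> U"
  then have "x s \<in> U" by (simp add: s_def)
  then obtain e where e: "e > 0" "ball (x s) e \<subseteq> U"
    using U open_contains_ball by blast
  obtain d where d: "d > 0" "\<And>u. 0 \<le> u \<Longrightarrow> dist u s < d \<Longrightarrow> dist (x u) (x s) < e"
    using x e(1) s(2) unfolding continuous_on_iff by (metis atLeast_iff)
  have "ennreal (s + d) \<le> exit_time U x"
  proof (rule le_exit_time)
    fix u assume u: "0 \<le> u" "u < s + d"
    show "x u \<in> U"
    proof (cases "u < s")
      case True
      then show ?thesis using in_before_exit_time[of s U x u] s u by simp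
    next
      case False
      then show ?thesis using d(2)[of u] e(2) u by (auto simp: dist_real_def dist_commute)
    qed
  qed
  then show False using s d by simp
qed

text \<open>For \<open>\<le>\<close>, a real time is a limit of dyadic times from below and the deep
  interiors are closed. For the converse, up to a dyadic time before the exit the path runs in a
  compact subset of \<open>U\<close>, which a single deep interior contains.\<close>

lemma exit_functional_sample:
  assumes U: "open U" and x: "continuous_on {0..} x"
  shows "exit_functional U (sample x) = exit_time U x"
proof (rule antisym)
  show "exit_functional U (sample x) \<le> exit_time U x"
    unfolding exit_functional_def
  proof (rule SUP_least, clarify, goal_cases)
    case (1 n k m)
    show ?case
    proof (cases "\<forall>i. dyadic i \<le> dyadic (k, m) \<longrightarrow> sample x i \<in> deep_interior U n")
      case True
      have "ennreal (dyadic (k, m)) \<le> exit_time U x"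
      proof (rule le_exit_time)
        fix s assume s: "0 \<le> s" "s < dyadic (k, m)"
        have "x s \<in> deep_interior U n"
        proof (rule closed_sequentially[OF closed_deep_interior])
          show "(\<lambda>l. x (dyadic (dyadic_floor l s))) \<longlonglongrightarrow> x s"
            by (intro path_tendsto x dyadic_floor_tendsto s) auto
          show "x (dyadic (dyadic_floor l s)) \<in> deep_interior U n" for l
            using True[rule_format, of "dyadic_floor l s"] dyadic_floor_bounds(1)[OF s(1), of l] s(2)
            by (simp add: sample_def)
        qed
        then show "x s \<in> U" using deep_interior_subset by blast
      qed
      then show ?thesis using True by simp
    next
      case False
      then show ?thesis by (simp only: if_False) simp
    qed
  qed
next
  show "exit_time U x \<le> exit_functional U (sample x)"
  proof (rule dense_le)
    fix r assume "r < exit_time U x"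
    then obtain r' where r': "r < r'" "r' < exit_time U x"
      using dense by blast
    have "r' < top" using r'(2) by (rule order_less_le_trans) simp
    moreover from r'(1) this have "r < top" by (rule order_less_trans)
    ultimately have rfin: "r = ennreal (enn2real r)" "r' = ennreal (enn2real r')"
      by simp_all
    have "enn2real r < enn2real r'"
      using r'(1) rfin by (metis ennreal_less_iff enn2real_nonneg)
    then obtain j where j: "enn2real r < dyadic j" "dyadic j < enn2real r'"
      using dyadic_between enn2real_nonneg by blast
    have "x ` {0..dyadic j} \<subseteq> U"
      using in_before_exit_time[of "enn2real r'" U x] r' rfin j by fastforce
    moreover have "compact (x ` {0..dyadic j})"
      by (intro compact_continuous_image continuous_on_subset[OF x]) auto
    ultimately obtain n where n: "x ` {0..dyadic j} \<subseteq> deep_interior U n"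
      using compact_subset_deep_interior[OF U] by blast
    have "r \<le> ennreal (dyadic j)"
      using j rfin by (metis ennreal_leI less_imp_le)
    also have "\<dots> = (if \<forall>i. dyadic i \<le> dyadic j \<longrightarrow> sample x i \<in> deep_interior U n then ennreal (dyadic j) else 0)"
    proof -
      have "\<forall>i. dyadic i \<le> dyadic j \<longrightarrow> sample x i \<in> deep_interior U n"
        using n by (simp add: sample_def image_subset_iff)
      then show ?thesis by (rule if_P[symmetric])
    qed
    also have "\<dots> \<le> exit_functional U (sample x)"
      unfolding exit_functional_def by (rule SUP_upper2[of "(n, j)"]) auto
    finally show "r \<le> exit_functional U (sample x)" .
  qed
qed

section \<open>Measurability on the path space\<close>

lemma measurable_exit_functional [measurable]: "exit_functional U \<in> borel_measurable path_space"
proof -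
  have [measurable]: "deep_interior U n \<in> sets borel" for n
    by (intro borel_closed closed_deep_interior)
  show ?thesis
    unfolding exit_functional_def[abs_def] by measurable
qed

text \<open>At each level the rounded time takes countably many values, so evaluation there is
  measurable although the time is random; the limit over the levels preserves this.\<close>

lemma measurable_eval_at [measurable]:
  assumes [measurable]: "f \<in> measurable N path_space" "g \<in> borel_measurable N"
  shows "(\<lambda>w. eval_at (f w) (g w)) \<in> borel_measurable N"
proof -
  have "(\<lambda>w. f w (dyadic_floor n (g w))) \<in> borel_measurable N" for n
  proof (rule measurable_compose_countable)
    show "(\<lambda>w. f w i) \<in> borel_measurable N" for i
      by measurable
    show "(\<lambda>w. dyadic_floor n (g w)) \<in> measurable N (count_space UNIV)"
      unfolding dyadic_floor_def by measurable
  qed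
  then show ?thesis
    unfolding eval_at_def by (rule borel_measurable_lim_metric)
qed

lemma measurable_shift_path [measurable (raw)]:
  assumes "f \<in> borel_measurable N" "g \<in> measurable N path_space"
  shows "(\<lambda>w i. f w + g w i) \<in> measurable N path_space"
  by (intro measurable_PiM_single' borel_measurable_add assms(1)
      measurable_compose[OF assms(2) measurable_component_singleton]) auto

lemma measurable_exit_functional_shift [measurable (raw)]:
  assumes "f \<in> borel_measurable N" "g \<in> measurable N path_space"
  shows "(\<lambda>w. exit_functional U (\<lambda>i. f w + g w i)) \<in> borel_measurable N"
  by (rule measurable_compose[OF measurable_shift_path[OF assms] measurable_exit_functional])

text \<open>The restarted paths are translated to begin at \<open>x s\<close> and converge to the
  path \<open>x (s + v)\<close> uniformly on bounded time intervals. As long as the limit path stays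
  in the open set \<open>U\<close>, so does a tube around it, and eventually the approximating
  paths. They may stay longer, so only an inequality can be expected.\<close>

lemma exit_time_lower_semicontinuous:
  assumes U: "open U" and x: "continuous_on {0..} x" and s: "0 \<le> s" "\<And>n. 0 \<le> u n" "u \<longlonglongrightarrow> s"
  shows "exit_time U (\<lambda>v. x (s + v)) \<le> liminf (\<lambda>n. exit_time U (\<lambda>v. x s - x (u n) + x (u n + v)))"
  unfolding le_Liminf_iff
proof (intro allI impI)
  fix y assume "y < exit_time U (\<lambda>v. x (s + v))"
  \<comment> \<open>Two intermediate values: \<open>r''\<close> keeps the path in \<open>U\<close>
    on a closed interval of length \<open>r\<close>, and \<open>r'\<close> yields the strict
    inequality for \<open>y\<close>.\<close>
  then obtain r' where r': "y < r'" "r' < exit_time U (\<lambda>v. x (s + v))"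
    using dense by blast
  then obtain r'' where r'': "r' < r''" "r'' < exit_time U (\<lambda>v. x (s + v))"
    using dense by blast
  define r where "r = enn2real r'"
  have "r' < top" using r''(1) by (rule order_less_le_trans) simp
  then have r: "r' = ennreal r" "0 \<le> r"
    by (auto simp: r_def)
  have "r'' < top" using r''(2) by (rule order_less_le_trans) simp
  then have rr: "r'' = ennreal (enn2real r'')" by simp
  have "r < enn2real r''"
    using r''(1) r rr by (metis ennreal_less_iff)
  then have "(\<lambda>v. x (s + v)) ` {0..r} \<subseteq> U"
    using in_before_exit_time[of "enn2real r''" U "\<lambda>v. x (s + v)"] r'' rr by fastforce
  moreover have "compact ((\<lambda>v. x (s + v)) ` {0..r})"
    using s by (intro compact_continuous_image continuous_on_compose2[OF x] continuous_intros) auto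
  ultimately obtain e where e: "e > 0" "(\<Union>z\<in>(\<lambda>v. x (s + v)) ` {0..r}. ball z e) \<subseteq> U"
    using compact_subset_open_imp_ball_epsilon_subset[OF _ U] by metis
  \<comment> \<open>The margin 1 accommodates \<open>u n + v\<close> once \<open>u n\<close> is
    within 1 of \<open>s\<close>. One \<open>e / 2\<close> is spent on the translation, the other on
    the time shift.\<close>
  have "uniformly_continuous_on {0..s + r + 1} x"
    by (intro compact_uniformly_continuous continuous_on_subset[OF x]) auto
  then obtain d where d: "d > 0" "\<And>v w. v \<in> {0..s + r + 1} \<Longrightarrow> w \<in> {0..s + r + 1} \<Longrightarrow>
      dist w v < d \<Longrightarrow> dist (x w) (x v) < e / 2"
    using e(1) unfolding uniformly_continuous_on_def by (metis half_gt_zero)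
  have "\<forall>\<^sub>F n in sequentially. dist (u n) s < min d 1"
    using s(3) d(1) by (intro tendstoD) auto
  then show "\<forall>\<^sub>F n in sequentially. y < exit_time U (\<lambda>v. x s - x (u n) + x (u n + v))"
  proof eventually_elim
    case (elim n)
    have "ennreal r \<le> exit_time U (\<lambda>v. x s - x (u n) + x (u n + v))"
    proof (rule le_exit_time)
      fix v assume v: "0 \<le> v" "v < r"
      have "dist (x s) (x (u n)) < e / 2"
        using elim r s by (intro d(2)) (auto simp: dist_real_def abs_less_iff)
      moreover have "dist (x (s + v)) (x (u n + v)) < e / 2"
        using elim r s(1) s(2)[of n] v by (intro d(2)) (auto simp: dist_real_def abs_less_iff)
      moreover have "dist (x (s + v)) (x s - x (u n) + x (u n + v)) =
          norm ((x (s + v) - x (u n + v)) - (x s - x (u n)))"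
        by (simp add: dist_norm algebra_simps)
      ultimately have "dist (x (s + v)) (x s - x (u n) + x (u n + v)) < e"
        using norm_triangle_ineq4[of "x (s + v) - x (u n + v)" "x s - x (u n)"]
        by (simp add: dist_norm)
      then show "x s - x (u n) + x (u n + v) \<in> U"
        using e(2) v by force
    qed
    then show ?case using r' r by simp
  qed
qed

text \<open>On leaving \<open>V\<close> the path is either outside \<open>W\<close> too, and has
  left the union, or it is in \<open>W\<close> on the boundary of \<open>V\<close>, and the exit
  time of the restarted path bounds the remainder.\<close>

lemma exit_time_union_le:
  assumes V: "open V" and W: "open W" and x: "continuous_on {0..} x" and start: "x 0 \<in> V"
  shows "exit_time (V \<union> W) x \<le> exit_time V x +
    (if exit_time V x < \<infinity> \<and> x (enn2real (exit_time V x)) \<in> frontier V \<inter> W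
     then exit_time (V \<union> W) (\<lambda>v. x (enn2real (exit_time V x) + v)) else 0)"
proof (cases "exit_time V x < \<infinity>")
  case False
  then show ?thesis by (simp add: less_top[symmetric])
next
  case True
  define s where "s = enn2real (exit_time V x)"
  have s: "exit_time V x = ennreal s" "0 \<le> s"
    using True by (auto simp: s_def)
  have xs: "x s \<notin> V"
    using exit_time_attained[OF V x True] by (simp add: s_def)
  \<comment> \<open>A positive exit time makes \<open>x s\<close> a limit of earlier points of
    \<open>V\<close>, so that it lies on the frontier and not merely outside
    \<open>V\<close>.\<close>
  then have "s > 0" using start s by (cases "s = 0") auto
  have lim: "(\<lambda>n. s - s / real (Suc n)) \<longlonglongrightarrow> s"
    using tendsto_diff[OF tendsto_const[of s] tendsto_mult_left[OF LIMSEQ_inverse_real_of_nat, of s]]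
    by (simp add: divide_inverse)
  have "x s \<in> closure V"
    unfolding closure_sequential
  proof (intro exI conjI allI)
    show "x (s - s / real (Suc n)) \<in> V" for n
      using \<open>s > 0\<close> s by (intro in_before_exit_time[of s]) (auto simp: field_simps)
    show "(\<lambda>n. x (s - s / real (Suc n))) \<longlonglongrightarrow> x s"
      using s \<open>s > 0\<close> by (intro path_tendsto x lim) (auto simp: field_simps)
  qed
  then have fr: "x s \<in> frontier V"
    using xs V by (simp add: frontier_def interior_open)
  show ?thesis
  proof (cases "x s \<in> W")
    case False
    then have "exit_time (V \<union> W) x \<le> ennreal s"
      using xs s by (intro exit_time_le) auto
    then show ?thesis using False s by (simp flip: s_def)
  next
    case inW: True
    define R where "R = exit_time (V \<union> W) (\<lambda>v. x (s + v))"
    have "exit_time (V \<union> W) x \<le> ennreal s + R"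
    proof (cases "R < \<infinity>")
      case False
      then show ?thesis by (simp add: less_top[symmetric])
    next
      case Rfin: True
      have "continuous_on {0..} (\<lambda>v. x (s + v))"
        using s by (intro continuous_on_compose2[OF x] continuous_intros) auto
      then have "x (s + enn2real R) \<notin> V \<union> W"
        using exit_time_attained[of "V \<union> W" "\<lambda>v. x (s + v)"] V W Rfin unfolding R_def by blast
      then have "exit_time (V \<union> W) x \<le> ennreal (s + enn2real R)"
        using s by (intro exit_time_le) auto
      also have "\<dots> = ennreal s + R"
        using s Rfin by simp
      finally show ?thesis .
    qed
    then show ?thesis using inW fr True s by (simp add: R_def flip: s_def)
  qed
qed

section \<open>Truncated powers of times\<close>

definition truncated_powr :: "real \<Rightarrow> real \<Rightarrow> ennreal \<Rightarrow> ennreal" where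
  "truncated_powr p K T = ennreal (enn2real (min T (ennreal K)) powr p)"

lemma mono_truncated_powr: "0 < p \<Longrightarrow> mono (truncated_powr p K)"
  unfolding truncated_powr_def
  by (intro monoI ennreal_leI powr_mono2 enn2real_mono min.mono) (auto simp: min_less_iff_disj)

lemma continuous_truncated_powr:
  assumes "0 < p"
  shows "continuous_on UNIV (truncated_powr p K)"
proof -
  have "continuous_on UNIV (\<lambda>T. enn2real (min T (ennreal K)))"
    unfolding continuous_on_def
  proof (intro ballI tendsto_enn2real)
    fix T
    have fin: "min T (ennreal K) < \<top>" by (simp add: min_less_iff_disj)
    have "((\<lambda>T. min T (ennreal K)) \<longlongrightarrow> min T (ennreal K)) (at T)"
      by (intro tendsto_min tendsto_ident_at tendsto_const)
    then show "((\<lambda>T. min T (ennreal K)) \<longlongrightarrow> ennreal (enn2real (min T (ennreal K)))) (at T)"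
      using fin by simp
  qed auto
  then have "continuous_on UNIV (\<lambda>T. enn2real (min T (ennreal K)) powr p)"
    using assms by (intro continuous_on_powr') (auto intro: continuous_intros)
  then show ?thesis
    unfolding truncated_powr_def[abs_def] by (intro continuous_on_ennreal)
qed

lemma measurable_truncated_powr:
  "0 < p \<Longrightarrow> truncated_powr p K \<in> borel_measurable borel"
  by (intro borel_measurable_continuous_onI continuous_truncated_powr)

text \<open>The truncated power is monotone and continuous on all of \<open>ennreal\<close>, so it
  commutes with the lower limit.\<close>

lemma truncated_powr_le_liminf:
  assumes "0 < p" "T \<le> liminf S"
  shows "truncated_powr p K T \<le> liminf (\<lambda>n. truncated_powr p K (S n))"
proof -
  have "truncated_powr p K T \<le> truncated_powr p K (liminf S)"
    using assms mono_truncated_powr by (auto dest: monoD)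
  also have "\<dots> = liminf (\<lambda>n. truncated_powr p K (S n))"
    using assms by (intro Liminf_compose_continuous_mono[symmetric] continuous_truncated_powr mono_truncated_powr) auto
  finally show ?thesis .
qed

lemma truncated_powr_le: "0 < p \<Longrightarrow> 0 \<le> K \<Longrightarrow> truncated_powr p K T \<le> ennreal (K powr p)"
  unfolding truncated_powr_def
  by (intro ennreal_leI powr_mono2) (auto intro: enn2real_leI)

lemma SUP_truncated_powr:
  assumes "0 < p"
  shows "(SUP n. truncated_powr p (real n) T) = ennreal_powr T p"
proof (cases "T = \<infinity>")
  case False
  then have T: "T = ennreal (enn2real T)" by (simp add: less_top)
  show ?thesis
  proof (rule antisym)
    have "truncated_powr p (real n) T \<le> ennreal_powr T p" for n
      unfolding truncated_powr_def ennreal_powr_def using False assms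
      by (auto intro!: ennreal_leI powr_mono2 enn2real_mono simp: less_top)
    then show "(SUP n. truncated_powr p (real n) T) \<le> ennreal_powr T p"
      by (rule SUP_least)
    obtain n where n: "enn2real T \<le> real n" using real_arch_simple by blast
    then have "min T (ennreal (real n)) = T"
      using T by (metis ennreal_leI min.absorb1)
    then show "ennreal_powr T p \<le> (SUP n. truncated_powr p (real n) T)"
      using False by (intro SUP_upper2[of n]) (auto simp: ennreal_powr_def truncated_powr_def)
  qed
next
  case True
  have "(SUP n. truncated_powr p (real n) T) = \<top>"
  proof (rule ennreal_SUP_eq_top)
    fix n :: nat
    \<comment> \<open>For infinite \<open>T\<close> the truncated power at level \<open>m\<close> is
      \<open>m powr p\<close>, which reaches \<open>n\<close> once \<open>m\<close> reaches
      \<open>n powr (1 / p)\<close>.\<close>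
    obtain m :: nat where m: "real n powr (1 / p) \<le> real m" using real_arch_simple by blast
    have "real n = (real n powr (1 / p)) powr p"
      using assms by (simp add: powr_powr)
    also have "\<dots> \<le> real m powr p"
      using m assms by (intro powr_mono2) auto
    finally have "of_nat n \<le> truncated_powr p (real m) T"
      using True by (simp add: truncated_powr_def ennreal_of_nat_eq_real_of_nat)
    then show "\<exists>i\<in>UNIV. of_nat n \<le> truncated_powr p (real i) T" by blast
  qed
  then show ?thesis using True by (simp add: ennreal_powr_def)
qed

text \<open>The dominant summand absorbs the other. With \<open>(1 + d) powr p = c\<close>, either
  \<open>x \<le> d * y\<close> and \<open>y\<close> receives the factor \<open>c\<close>, or
  \<open>y < x / d\<close> and the cost falls on \<open>x\<close>. The factor near 1 is kept for
  \<open>y\<close> because that term is iterated later.\<close>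

lemma powr_add_le:
  fixes p c :: real
  assumes "0 < p" "1 < c"
  obtains C where "0 < C" "\<And>x y. 0 \<le> x \<Longrightarrow> 0 \<le> y \<Longrightarrow> (x + y) powr p \<le> C * x powr p + c * y powr p"
proof
  define d where "d = c powr (1 / p) - 1"
  have "1 < c powr (1 / p)"
    using assms by (intro gr_one_powr) auto
  then have d: "0 < d" by (simp add: d_def)
  have dp: "(1 + d) powr p = c"
    using assms by (simp add: d_def powr_powr)
  show "0 < (1 + 1 / d) powr p"
  proof -
    have "0 < 1 + 1 / d" using d by (simp add: add_pos_pos)
    then show ?thesis by simp
  qed
  fix x y :: real assume xy: "0 \<le> x" "0 \<le> y"
  show "(x + y) powr p \<le> (1 + 1 / d) powr p * x powr p + c * y powr p"
  proof (cases "x \<le> d * y")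
    case True
    then have "(x + y) powr p \<le> ((1 + d) * y) powr p"
      using xy assms by (intro powr_mono2) (auto simp: algebra_simps)
    also have "\<dots> = c * y powr p"
      using xy d dp by (simp add: powr_mult)
    finally show ?thesis by (simp add: add_increasing)
  next
    case False
    then have "(x + y) powr p \<le> ((1 + 1 / d) * x) powr p"
      using xy assms d by (intro powr_mono2) (auto simp: field_simps)
    also have "\<dots> = (1 + 1 / d) powr p * x powr p"
      using xy d by (simp add: powr_mult)
    finally show ?thesis using assms by (simp add: add_increasing2)
  qed
qed

text \<open>Since \<open>min A K \<le> T + min R K\<close>, the truncation can be left on the second
  leg alone. \<open>C\<close> is fixed before \<open>K\<close>, which makes the later bounds uniform
  in \<open>K\<close>.\<close>

lemma truncated_powr_add_le:
  fixes p c :: real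
  assumes "0 < p" "1 < c"
  obtains C where "0 < C" "\<And>K A T R. 0 \<le> K \<Longrightarrow> A \<le> T + R \<Longrightarrow>
    truncated_powr p K A \<le> ennreal C * ennreal_powr T p + ennreal c * truncated_powr p K R"
proof -
  obtain C where C: "0 < C" "\<And>x y. 0 \<le> x \<Longrightarrow> 0 \<le> y \<Longrightarrow> (x + y) powr p \<le> C * x powr p + c * y powr p"
    using powr_add_le[OF assms] by metis
  have "truncated_powr p K A \<le> ennreal C * ennreal_powr T p + ennreal c * truncated_powr p K R"
    if "0 \<le> K" "A \<le> T + R" for K A T R
  proof (cases "T = \<infinity>")
    case True
    then show ?thesis using C(1) by (simp add: ennreal_powr_def ennreal_mult_top)
  next
    case False
    let ?R = "enn2real (min R (ennreal K))"
    have R: "min R (ennreal K) = ennreal ?R"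
      by (simp add: min_less_iff_disj)
    have T: "T = ennreal (enn2real T)" using False by (simp add: less_top)
    have "min A (ennreal K) \<le> T + min R (ennreal K)"
    proof (cases "R \<le> ennreal K")
      case True
      then show ?thesis using that by (simp add: min.coboundedI1 min.absorb1)
    next
      case False
      then have "min R (ennreal K) = ennreal K" by simp
      then show ?thesis by (metis add_increasing le_cases min.coboundedI2 order_refl zero_le)
    qed
    also have "\<dots> = ennreal (enn2real T + ?R)"
      using R T by (metis ennreal_plus enn2real_nonneg)
    finally have "enn2real (min A (ennreal K)) powr p \<le> (enn2real T + ?R) powr p"
      using assms by (intro powr_mono2) (auto intro: enn2real_leI)
    also have "\<dots> \<le> C * enn2real T powr p + c * ?R powr p"
      by (intro C) auto
    finally have "truncated_powr p K A \<le> ennreal (C * enn2real T powr p + c * ?R powr p)"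
      unfolding truncated_powr_def by (rule ennreal_leI)
    also have "\<dots> = ennreal C * ennreal_powr T p + ennreal c * truncated_powr p K R"
      using False C(1) assms by (simp add: ennreal_powr_def truncated_powr_def ennreal_mult)
    finally show ?thesis .
  qed
  with C(1) show thesis by (rule that)
qed

section \<open>The strong Markov property at exit times\<close>

lemma exit_time_eq_if_agree:
  assumes V: "open V" and x: "continuous_on {0..} x"
    and agree: "\<And>s. 0 \<le> s \<Longrightarrow> s \<le> t \<Longrightarrow> y s = x s"
    and less: "exit_time V x < ennreal t"
  shows "exit_time V y = exit_time V x"
proof -
  have fin: "exit_time V x < \<infinity>"
    using less by (rule order_less_le_trans) simp
  define s where "s = enn2real (exit_time V x)"
  have s: "exit_time V x = ennreal s" "0 \<le> s"
    using fin by (auto simp: s_def)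
  have st: "s < t"
    using less s by (simp add: ennreal_less_iff)
  have "x s \<notin> V"
    using exit_time_attained[OF V x fin] by (simp add: s_def)
  then have "exit_time V y \<le> ennreal s"
    using agree st s by (intro exit_time_le) auto
  moreover have "ennreal s \<le> exit_time V y"
    using in_before_exit_time[of s V x] s st agree by (intro le_exit_time) auto
  ultimately show ?thesis using s by simp
qed

text \<open>The stopping time property: whether the exit comes before \<open>t\<close>, and when, is
  decided by the path up to \<open>t\<close>. The converse direction takes the stopped path as the
  reference path in \<open>exit_time_eq_if_agree\<close>.\<close>

lemma exit_time_stopped:
  assumes V: "open V" and x: "continuous_on {0..} x" and t: "0 \<le> t"
  shows "exit_time V (\<lambda>s. x (min t s)) < ennreal t \<longleftrightarrow> exit_time V x < ennreal t"
    and "exit_time V x < ennreal t \<Longrightarrow> exit_time V (\<lambda>s. x (min t s)) = exit_time V x"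
proof -
  have c: "continuous_on {0..} (\<lambda>s. x (min t s))"
    using t by (intro continuous_on_compose2[OF x] continuous_intros) auto
  show 1: "exit_time V x < ennreal t \<Longrightarrow> exit_time V (\<lambda>s. x (min t s)) = exit_time V x"
    by (rule exit_time_eq_if_agree[OF V x]) auto
  have "exit_time V (\<lambda>s. x (min t s)) < ennreal t \<Longrightarrow> exit_time V x = exit_time V (\<lambda>s. x (min t s))"
    by (rule exit_time_eq_if_agree[OF V c]) auto
  with 1 show "exit_time V (\<lambda>s. x (min t s)) < ennreal t \<longleftrightarrow> exit_time V x < ennreal t"
    by auto
qed

definition exit_point :: "complex set \<Rightarrow> (nat \<times> nat \<Rightarrow> complex) \<Rightarrow> complex" where
  "exit_point V y = eval_at y (enn2real (exit_functional V y))"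

text \<open>For fixed \<open>n\<close> these events split the exits through \<open>S\<close>
  according to the half-open grid interval \<open>[j / 2 ^ n, (j + 1) / 2 ^ n)\<close> that contains
  the exit time.\<close>

definition exit_event :: "complex set \<Rightarrow> complex set \<Rightarrow> nat \<Rightarrow> nat \<Rightarrow> (nat \<times> nat \<Rightarrow> complex) set" where
  "exit_event V S n j = {y \<in> space path_space. exit_functional V y < \<infinity> \<and>
     dyadic_floor n (enn2real (exit_functional V y)) = (j, n) \<and> exit_point V y \<in> S}"

lemma measurable_exit_point [measurable]: "exit_point V \<in> borel_measurable path_space"
  unfolding exit_point_def[abs_def] by measurable

lemma sets_exit_event [measurable]:
  assumes [measurable]: "S \<in> sets borel"
  shows "exit_event V S n j \<in> sets path_space"
proof -
  have [measurable]: "(\<lambda>y. dyadic_floor n (enn2real (exit_functional V y))) \<in> measurable path_space (count_space UNIV)"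
    unfolding dyadic_floor_def by measurable
  show ?thesis
    unfolding exit_event_def by measurable
qed

lemma exit_point_sample:
  assumes "open V" "continuous_on {0..} x"
  shows "exit_point V (sample x) = x (enn2real (exit_time V x))"
  using assms by (simp add: exit_point_def exit_functional_sample eval_at_sample)

lemma sample_in_exit_event_iff:
  assumes "open V" "continuous_on {0..} x"
  shows "sample x \<in> exit_event V S n j \<longleftrightarrow> exit_time V x < \<infinity> \<and>
     dyadic_floor n (enn2real (exit_time V x)) = (j, n) \<and> x (enn2real (exit_time V x)) \<in> S"
  using assms by (simp add: exit_event_def exit_functional_sample exit_point_sample space_PiM)

text \<open>\<open>t\<close> is the excluded right end of the grid interval, so the exit strictly
  precedes \<open>t\<close>, and both the event and the exit point can be read off the path stopped
  at \<open>t\<close>.\<close>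

lemma exit_event_stopped:
  fixes j n :: nat
  assumes V: "open V" and x: "continuous_on {0..} x"
  defines "t \<equiv> dyadic (Suc j, n)"
  shows "sample (\<lambda>s. x (min t s)) \<in> exit_event V S n j \<longleftrightarrow> sample x \<in> exit_event V S n j"
    and "sample x \<in> exit_event V S n j \<Longrightarrow>
      exit_point V (sample (\<lambda>s. x (min t s))) = x (enn2real (exit_time V x))"
proof -
  have t: "0 \<le> t" by (simp add: t_def)
  let ?y = "\<lambda>s. x (min t s)"
  have c: "continuous_on {0..} ?y"
    using t by (intro continuous_on_compose2[OF x] continuous_intros) auto
  have before: "T < ennreal t"
    if "T < \<infinity>" "dyadic_floor n (enn2real T) = (j, n)" for T
  proof -
    have "enn2real T < dyadic (j, n) + 1 / 2 ^ n"
      using dyadic_floor_bounds(2)[of "enn2real T" n] that by simp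
    also have "\<dots> = t"
      by (simp add: t_def dyadic_def add_divide_distrib)
    finally show ?thesis
      using that by (metis enn2real_nonneg ennreal_enn2real ennreal_less_iff infinity_ennreal_def)
  qed
  have eq: "exit_time V ?y = exit_time V x" "?y (enn2real (exit_time V x)) = x (enn2real (exit_time V x))"
    if "exit_time V x < ennreal t"
  proof -
    show "exit_time V ?y = exit_time V x"
      using exit_time_stopped(2)[OF V x t that] .
    have "enn2real (exit_time V x) \<le> t"
      using that t by (intro enn2real_leI) auto
    then show "?y (enn2real (exit_time V x)) = x (enn2real (exit_time V x))"
      by (simp add: min_absorb2)
  qed
  show iff: "sample ?y \<in> exit_event V S n j \<longleftrightarrow> sample x \<in> exit_event V S n j"
    unfolding sample_in_exit_event_iff[OF V x] sample_in_exit_event_iff[OF V c]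
    using before eq exit_time_stopped(1)[OF V x t] by metis
  assume "sample x \<in> exit_event V S n j"
  then have "exit_time V x < ennreal t"
    unfolding sample_in_exit_event_iff[OF V x] using before by blast
  with eq show "exit_point V (sample ?y) = x (enn2real (exit_time V x))"
    unfolding exit_point_sample[OF V c] by simp
qed

section \<open>Integration over past and future\<close>

context planar_bm
begin

text \<open>Independence turns the joint law into a product, Fubini integrates the future first, and
  stationarity replaces its law by that of \<open>future B 0\<close>, the same for every
  \<open>i\<close>.\<close>

lemma nn_integral_past_future:
  fixes G :: "(nat \<times> nat \<Rightarrow> complex) \<Rightarrow> (nat \<times> nat \<Rightarrow> complex) \<Rightarrow> ennreal"
  assumes [measurable]: "(\<lambda>(y, z). G y z) \<in> borel_measurable (path_space \<Otimes>\<^sub>M path_space)"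
  shows "(\<integral>\<^sup>+ \<omega>. G (past B (dyadic i) \<omega>) (future B (dyadic i) \<omega>) \<partial>M) =
    (\<integral>\<^sup>+ \<omega>. (\<integral>\<^sup>+ z. G (past B (dyadic i) \<omega>) z \<partial>distr M path_space (future B 0)) \<partial>M)"
proof -
  let ?p = "past B (dyadic i)" and ?f = "future B (dyadic i)"
  have [measurable]: "?p \<in> measurable M path_space" "?f \<in> measurable M path_space"
    by (simp_all add: measurable_past measurable_future)
  interpret F: prob_space "distr M path_space ?f"
    by (rule prob_space_distr) measurable
  have 0: "dyadic (0, 0) = 0" by (simp add: dyadic_def)
  have "distr M path_space ?p \<Otimes>\<^sub>M distr M path_space ?f =
      distr M (path_space \<Otimes>\<^sub>M path_space) (\<lambda>\<omega>. (?p \<omega>, ?f \<omega>))"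
    using indep_past_future[of "fst i" "snd i"] unfolding indep_var_distribution_eq by simp
  then have "(\<integral>\<^sup>+ \<omega>. G (?p \<omega>) (?f \<omega>) \<partial>M) =
      (\<integral>\<^sup>+ (y, z). G y z \<partial>(distr M path_space ?p \<Otimes>\<^sub>M distr M path_space ?f))"
    by (simp add: nn_integral_distr)
  also have "\<dots> = (\<integral>\<^sup>+ y. (\<integral>\<^sup>+ z. G y z \<partial>distr M path_space ?f) \<partial>distr M path_space ?p)"
    by (subst F.nn_integral_fst[symmetric]) auto
  also have "\<dots> = (\<integral>\<^sup>+ \<omega>. (\<integral>\<^sup>+ z. G (?p \<omega>) z \<partial>distr M path_space ?f) \<partial>M)"
    by (subst nn_integral_distr) auto
  also have "distr M path_space ?f = distr M path_space (future B 0)"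
    using distr_future_eq[OF brownian brownian, of i "(0, 0)"] by (simp add: 0)
  finally show ?thesis .
qed

text \<open>Writing the motion as \<open>a\<close> plus its increments moves the starting point into
  the integrand, so different starting points can be compared under one measure.\<close>

lemma nn_integral_truncated_exit_time:
  assumes U: "open U" and p: "0 < p"
  shows "(\<integral>\<^sup>+ \<omega>. truncated_powr p K (exit_time U (\<lambda>t. B t \<omega>)) \<partial>M) =
    (\<integral>\<^sup>+ z. truncated_powr p K (exit_functional U (\<lambda>i. a + z i)) \<partial>distr M path_space (future B 0))"
proof -
  note [measurable] = measurable_truncated_powr[OF p] measurable_future
  have "(\<integral>\<^sup>+ z. truncated_powr p K (exit_functional U (\<lambda>i. a + z i)) \<partial>distr M path_space (future B 0)) =
      (\<integral>\<^sup>+ \<omega>. truncated_powr p K (exit_functional U (\<lambda>i. a + future B 0 \<omega> i)) \<partial>M)"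
    by (subst nn_integral_distr) auto
  also have "\<dots> = (\<integral>\<^sup>+ \<omega>. truncated_powr p K (exit_time U (\<lambda>t. B t \<omega>)) \<partial>M)"
  proof (rule nn_integral_cong_AE, use AE_start AE_space in eventually_elim)
    case (elim \<omega>)
    then have "(\<lambda>i. a + future B 0 \<omega> i) = sample (\<lambda>t. B t \<omega>)"
      by (simp add: future_def sample_def)
    then show ?case
      using exit_functional_sample[OF U continuous_B[OF elim(2)]] by simp
  qed
  finally show ?thesis ..
qed

lemma measurable_exit_time:
  assumes "open V"
  shows "(\<lambda>\<omega>. exit_time V (\<lambda>t. B t \<omega>)) \<in> borel_measurable M"
proof -
  have [measurable]: "(\<lambda>\<omega>. sample (\<lambda>t. B t \<omega>)) \<in> measurable M path_space"
    unfolding sample_def by (rule measurable_PiM_single') (auto intro: measurable_B)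
  have "(\<lambda>\<omega>. exit_functional V (sample (\<lambda>t. B t \<omega>))) \<in> borel_measurable M"
    by measurable
  then show ?thesis
    using exit_functional_sample[OF assms continuous_B] by (simp cong: measurable_cong)
qed

text \<open>
  The future is attached to \<open>x T\<close> rather than to \<open>x\<close> at the dyadic approximation of \<open>T\<close>:
  the restarted path then begins exactly in \<open>S\<close>, where the hypothesis applies, and the
  approximation error is absorbed by lower semicontinuity of the exit time and Fatou's lemma.
\<close>

lemma strong_markov_bound:
  assumes V: "open V" and U: "open U" and S [measurable]: "S \<in> sets borel" and p: "0 < p"
    and bound: "\<And>b. b \<in> S \<Longrightarrow>
      (\<integral>\<^sup>+ z. truncated_powr p K (exit_functional U (\<lambda>i. b + z i)) \<partial>distr M path_space (future B 0)) \<le> c"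
  defines "T \<equiv> \<lambda>\<omega>. exit_time V (\<lambda>t. B t \<omega>)"
  obtains h where "h \<in> borel_measurable M"
    "AE \<omega> in M. T \<omega> < \<infinity> \<longrightarrow> B (enn2real (T \<omega>)) \<omega> \<in> S \<longrightarrow>
       truncated_powr p K (exit_time U (\<lambda>v. B (enn2real (T \<omega>) + v) \<omega>)) \<le> h \<omega>"
    "(\<integral>\<^sup>+ \<omega>. h \<omega> \<partial>M) \<le> c * emeasure M {\<omega> \<in> space M. T \<omega> < \<infinity> \<and> B (enn2real (T \<omega>)) \<omega> \<in> S}"
proof -
  note [measurable] = measurable_truncated_powr[OF p] measurable_future measurable_past
  \<comment> \<open>\<open>x\<close> starts at \<open>a\<close> on every path and agrees with
    \<open>B\<close> almost surely; stopped at \<open>t\<close> and sampled, it is \<open>a\<close>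
    plus the past.\<close>
  define x where "x \<omega> s = a + (B s \<omega> - B 0 \<omega>)" for \<omega> s
  define st where "st t \<omega> = (\<lambda>i. a + past B t \<omega> i)" for t \<omega>
  define \<tau> where "\<tau> \<omega> = exit_time V (x \<omega>)" for \<omega>
  define G where "G n j y z = indicator (exit_event V S n j) y *
      truncated_powr p K (exit_functional U (\<lambda>i. exit_point V y + z i))" for n j y z
  \<comment> \<open>The right end of grid interval \<open>j\<close>, by which an exit within that
    interval has already happened.\<close>
  define t where "t n j = dyadic (Suc j, n)" for n j
  \<comment> \<open>For each outcome at most one summand is nonzero, namely that of the grid
    interval containing the exit time.\<close>
  define u where "u n \<omega> = (\<Sum>j. G n j (st (t n j) \<omega>) (future B (t n j) \<omega>))" for n \<omega>
  define A where "A n j = {\<omega> \<in> space M. sample (x \<omega>) \<in> exit_event V S n j}" for n j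
  have t0 [simp]: "0 \<le> t n j" for n j by (simp add: t_def)
  have x: "continuous_on {0..} (x \<omega>)" if "\<omega> \<in> space M" for \<omega>
    unfolding x_def using continuous_B[OF that] by (intro continuous_intros)
  have AE_x: "AE \<omega> in M. (\<lambda>s. B s \<omega>) = x \<omega>"
    using AE_start by eventually_elim (simp add: x_def fun_eq_iff)
  have st: "st t \<omega> = sample (\<lambda>s. x \<omega> (min t s))" for t \<omega>
    by (simp add: st_def x_def past_def sample_def)
  have [measurable]: "(\<lambda>\<omega>. sample (x \<omega>)) \<in> measurable M path_space"
    unfolding sample_def x_def
    by (rule measurable_PiM_single') (auto intro!: borel_measurable_add borel_measurable_diff measurable_B)
  have [measurable]: "st (t n j) \<in> measurable M path_space" for n j
    unfolding st_def[abs_def] by (intro measurable_shift_path measurable_past) auto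
  have [measurable]: "(\<lambda>(y, z). G n j y z) \<in> borel_measurable (path_space \<Otimes>\<^sub>M path_space)" for n j
    unfolding G_def by measurable
  have [measurable]: "A n j \<in> sets M" for n j
    unfolding A_def by measurable
  have [measurable]: "future B (t n j) \<in> measurable M path_space" for n j
    by (rule measurable_future) simp
  have [measurable]: "u n \<in> borel_measurable M" for n
    unfolding u_def[abs_def] by measurable
  \<comment> \<open>Given the past, the integral over the future is the one in \<open>bound\<close>
    with \<open>b\<close> the exit point, which lies in \<open>S\<close> on the event; off the event
    it vanishes.\<close>
  have term_le: "(\<integral>\<^sup>+ \<omega>. G n j (st (t n j) \<omega>) (future B (t n j) \<omega>) \<partial>M) \<le> c * emeasure M (A n j)" for n j
  proof -
    have [measurable]: "(\<lambda>(y, z). G n j (\<lambda>i. a + y i) z) \<in> borel_measurable (path_space \<Otimes>\<^sub>M path_space)"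
      unfolding G_def by measurable
    have "(\<integral>\<^sup>+ \<omega>. G n j (st (t n j) \<omega>) (future B (t n j) \<omega>) \<partial>M) =
        (\<integral>\<^sup>+ \<omega>. (\<integral>\<^sup>+ z. G n j (st (t n j) \<omega>) z \<partial>distr M path_space (future B 0)) \<partial>M)"
      unfolding st_def t_def by (rule nn_integral_past_future) measurable
    also have "\<dots> \<le> (\<integral>\<^sup>+ \<omega>. c * indicator (A n j) \<omega> \<partial>M)"
    proof (rule nn_integral_mono)
      fix \<omega> assume \<omega>: "\<omega> \<in> space M"
      show "(\<integral>\<^sup>+ z. G n j (st (t n j) \<omega>) z \<partial>distr M path_space (future B 0)) \<le> c * indicator (A n j) \<omega>"
      proof (cases "sample (x \<omega>) \<in> exit_event V S n j")
        case True
        then have "st (t n j) \<omega> \<in> exit_event V S n j"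
          using exit_event_stopped(1)[OF V x[OF \<omega>]] by (simp add: st t_def)
        then show ?thesis
          using True \<omega> bound[of "exit_point V (st (t n j) \<omega>)"]
          by (simp add: G_def A_def exit_event_def)
      next
        case False
        then have "st (t n j) \<omega> \<notin> exit_event V S n j"
          using exit_event_stopped(1)[OF V x[OF \<omega>]] by (simp add: st t_def)
        then show ?thesis by (simp add: G_def)
      qed
    qed
    also have "\<dots> = c * emeasure M (A n j)"
      by (simp add: nn_integral_cmult_indicator)
    finally show ?thesis .
  qed
  have in_A: "\<omega> \<in> A n j \<longleftrightarrow> \<omega> \<in> space M \<and> \<tau> \<omega> < \<infinity> \<and>
      dyadic_floor n (enn2real (\<tau> \<omega>)) = (j, n) \<and> x \<omega> (enn2real (\<tau> \<omega>)) \<in> S" for n j \<omega>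
    unfolding A_def \<tau>_def using sample_in_exit_event_iff[OF V x] by auto
  have UN_A: "(\<Union>j. A n j) = {\<omega> \<in> space M. \<tau> \<omega> < \<infinity> \<and> x \<omega> (enn2real (\<tau> \<omega>)) \<in> S}" for n
    by (auto simp: in_A dyadic_floor_def)
  have int_u: "(\<integral>\<^sup>+ \<omega>. u n \<omega> \<partial>M) \<le> c * emeasure M {\<omega> \<in> space M. \<tau> \<omega> < \<infinity> \<and> x \<omega> (enn2real (\<tau> \<omega>)) \<in> S}" for n
  proof -
    have "(\<integral>\<^sup>+ \<omega>. u n \<omega> \<partial>M) = (\<Sum>j. \<integral>\<^sup>+ \<omega>. G n j (st (t n j) \<omega>) (future B (t n j) \<omega>) \<partial>M)"
      unfolding u_def by (rule nn_integral_suminf) measurable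
    also have "\<dots> \<le> (\<Sum>j. c * emeasure M (A n j))"
      by (intro suminf_le term_le) auto
    also have "\<dots> = c * emeasure M (\<Union>j. A n j)"
    proof -
      have "disjoint_family (A n)"
        by (auto simp: disjoint_family_on_def in_A)
      then show ?thesis by (subst suminf_emeasure[symmetric]) auto
    qed
    finally show ?thesis by (simp add: UN_A)
  qed
  have lower: "truncated_powr p K (exit_time U (\<lambda>v. x \<omega> (enn2real (\<tau> \<omega>) + v))) \<le> liminf (\<lambda>n. u n \<omega>)"
    if \<omega>: "\<omega> \<in> space M" and fin: "\<tau> \<omega> < \<infinity>" "x \<omega> (enn2real (\<tau> \<omega>)) \<in> S" for \<omega>
  proof -
    define s where "s = enn2real (\<tau> \<omega>)"
    define j where "j n = fst (dyadic_floor n s)" for n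
    have tj: "t n (j n) = dyadic (dyadic_floor n s) + 1 / 2 ^ n" for n
      by (simp add: t_def j_def dyadic_def dyadic_floor_def add_divide_distrib)
    have "(\<lambda>n. t n (j n)) \<longlonglongrightarrow> s"
      unfolding tj using tendsto_add[OF dyadic_floor_tendsto inverse_two_power_tendsto_0, of s]
      by (simp add: s_def)
    then have "exit_time U (\<lambda>v. x \<omega> (s + v)) \<le>
        liminf (\<lambda>n. exit_time U (\<lambda>v. x \<omega> s - x \<omega> (t n (j n)) + x \<omega> (t n (j n) + v)))"
      by (intro exit_time_lower_semicontinuous U x \<omega>) (auto simp: s_def)
    then have "truncated_powr p K (exit_time U (\<lambda>v. x \<omega> (s + v))) \<le>
        liminf (\<lambda>n. truncated_powr p K (exit_time U (\<lambda>v. x \<omega> s - x \<omega> (t n (j n)) + x \<omega> (t n (j n) + v))))"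
      by (rule truncated_powr_le_liminf[OF p])
    also have "\<dots> \<le> liminf (\<lambda>n. u n \<omega>)"
    proof (intro Liminf_mono always_eventually allI)
      fix n
      have "\<omega> \<in> A n (j n)"
        using \<omega> fin by (simp add: in_A j_def s_def dyadic_floor_def)
      then have ev: "sample (x \<omega>) \<in> exit_event V S n (j n)"
        by (simp add: A_def)
      have "(\<lambda>i. x \<omega> s + future B (t n (j n)) \<omega> i) =
          sample (\<lambda>v. x \<omega> s - x \<omega> (t n (j n)) + x \<omega> (t n (j n) + v))"
        by (simp add: sample_def future_def x_def fun_eq_iff)
      moreover have "continuous_on {0..} (\<lambda>v. x \<omega> s - x \<omega> (t n (j n)) + x \<omega> (t n (j n) + v))"
        by (intro continuous_intros continuous_on_compose2[OF x[OF \<omega>]]) auto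
      moreover have "exit_point V (st (t n (j n)) \<omega>) = x \<omega> s"
        unfolding st t_def s_def \<tau>_def by (rule exit_event_stopped(2)[OF V x[OF \<omega>] ev])
      moreover have "st (t n (j n)) \<omega> \<in> exit_event V S n (j n)"
        using exit_event_stopped(1)[OF V x[OF \<omega>]] ev by (simp add: st t_def)
      ultimately have "truncated_powr p K (exit_time U (\<lambda>v. x \<omega> s - x \<omega> (t n (j n)) + x \<omega> (t n (j n) + v))) =
          G n (j n) (st (t n (j n)) \<omega>) (future B (t n (j n)) \<omega>)"
        using exit_functional_sample[OF U] by (simp add: G_def)
      also have "\<dots> = (\<Sum>k\<in>{j n}. G n k (st (t n k) \<omega>) (future B (t n k) \<omega>))"
        by simp
      also have "\<dots> \<le> u n \<omega>"
        unfolding u_def by (rule sum_le_suminf) auto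
      finally show "truncated_powr p K (exit_time U (\<lambda>v. x \<omega> s - x \<omega> (t n (j n)) + x \<omega> (t n (j n) + v))) \<le> u n \<omega>" .
    qed
    finally show ?thesis by (simp add: s_def)
  qed
  show thesis
  proof
    \<comment> \<open>The lower limit is measurable by construction and dominates the truncated
      power after the restart, so the restarted exit time never has to be integrated itself.\<close>
    show "(\<lambda>\<omega>. liminf (\<lambda>n. u n \<omega>)) \<in> borel_measurable M"
      by measurable
    show "AE \<omega> in M. T \<omega> < \<infinity> \<longrightarrow> B (enn2real (T \<omega>)) \<omega> \<in> S \<longrightarrow>
        truncated_powr p K (exit_time U (\<lambda>v. B (enn2real (T \<omega>) + v) \<omega>)) \<le> liminf (\<lambda>n. u n \<omega>)"
      using AE_x AE_space
    proof eventually_elim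
      case (elim \<omega>)
      have "B s \<omega> = x \<omega> s" for s using elim(1) by (rule fun_cong)
      then show ?case using lower[OF elim(2)] by (simp add: T_def \<tau>_def)
    qed
    have "(\<integral>\<^sup>+ \<omega>. liminf (\<lambda>n. u n \<omega>) \<partial>M) \<le> liminf (\<lambda>n. \<integral>\<^sup>+ \<omega>. u n \<omega> \<partial>M)"
      by (rule nn_integral_liminf) measurable
    also have "\<dots> \<le> liminf (\<lambda>n :: nat. c * emeasure M {\<omega> \<in> space M. \<tau> \<omega> < \<infinity> \<and> x \<omega> (enn2real (\<tau> \<omega>)) \<in> S})"
      by (intro Liminf_mono always_eventually allI int_u)
    also have "\<dots> = c * emeasure M {\<omega> \<in> space M. \<tau> \<omega> < \<infinity> \<and> x \<omega> (enn2real (\<tau> \<omega>)) \<in> S}"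
      by (simp add: Liminf_const)
    also have "emeasure M {\<omega> \<in> space M. \<tau> \<omega> < \<infinity> \<and> x \<omega> (enn2real (\<tau> \<omega>)) \<in> S} =
        emeasure M {\<omega> \<in> space M. T \<omega> < \<infinity> \<and> B (enn2real (T \<omega>)) \<omega> \<in> S}"
    proof (rule emeasure_eq_AE)
      show "AE \<omega> in M. \<omega> \<in> {\<omega> \<in> space M. \<tau> \<omega> < \<infinity> \<and> x \<omega> (enn2real (\<tau> \<omega>)) \<in> S} \<longleftrightarrow>
          \<omega> \<in> {\<omega> \<in> space M. T \<omega> < \<infinity> \<and> B (enn2real (T \<omega>)) \<omega> \<in> S}"
        using AE_x
      proof eventually_elim
        case (elim \<omega>)
        have "B s \<omega> = x \<omega> s" for s using elim by (rule fun_cong)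
        then show ?case by (simp add: T_def \<tau>_def)
      qed
      show "{\<omega> \<in> space M. \<tau> \<omega> < \<infinity> \<and> x \<omega> (enn2real (\<tau> \<omega>)) \<in> S} \<in> sets M"
        unfolding UN_A[of 0, symmetric] by measurable
      have [measurable]: "(\<lambda>\<omega>. sample (\<lambda>t. B t \<omega>)) \<in> measurable M path_space"
        unfolding sample_def by (rule measurable_PiM_single') (auto intro: measurable_B)
      have "{\<omega> \<in> space M. T \<omega> < \<infinity> \<and> B (enn2real (T \<omega>)) \<omega> \<in> S} =
          {\<omega> \<in> space M. exit_functional V (sample (\<lambda>t. B t \<omega>)) < \<infinity> \<and> exit_point V (sample (\<lambda>t. B t \<omega>)) \<in> S}"
        using exit_functional_sample[OF V continuous_B] exit_point_sample[OF V continuous_B]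
        by (auto simp: T_def)
      also have "\<dots> \<in> sets M" by measurable
      finally show "{\<omega> \<in> space M. T \<omega> < \<infinity> \<and> B (enn2real (T \<omega>)) \<omega> \<in> S} \<in> sets M" .
    qed
    finally show "(\<integral>\<^sup>+ \<omega>. liminf (\<lambda>n. u n \<omega>) \<partial>M) \<le>
        c * emeasure M {\<omega> \<in> space M. T \<omega> < \<infinity> \<and> B (enn2real (T \<omega>)) \<omega> \<in> S}" .
  qed
qed

end

section \<open>Moments of the exit time from the union\<close>

definition truncated_moment ::
    "(complex \<Rightarrow> 'w measure) \<Rightarrow> (real \<Rightarrow> 'w \<Rightarrow> complex) \<Rightarrow> real \<Rightarrow> real \<Rightarrow> complex set \<Rightarrow> complex \<Rightarrow> ennreal" where
  "truncated_moment P B p K U a = (\<integral>\<^sup>+ \<omega>. truncated_powr p K (exit_time U (\<lambda>t. B t \<omega>)) \<partial>P a)"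

text \<open>The time is split at the exit from \<open>V\<close>. The first leg contributes its own
  moment; a second leg occurs only after an exit through \<open>frontier V \<inter> W\<close>, and
  by the strong Markov bound it costs at most \<open>c\<close> times the probability of that
  exit.\<close>

lemma truncated_moment_step:
  assumes bm: "\<And>a. planar_brownian_motion (P a) B a" and p: "0 < p" and K: "0 \<le> K"
    and V: "open V" and W: "open W" and a: "a \<in> V"
    and C: "\<And>K A T R. 0 \<le> K \<Longrightarrow> A \<le> T + R \<Longrightarrow>
      truncated_powr p K A \<le> C * ennreal_powr T p + l * truncated_powr p K R"
    and c: "\<And>b. b \<in> frontier V \<inter> W \<Longrightarrow> truncated_moment P B p K (V \<union> W) b \<le> c"
  shows "truncated_moment P B p K (V \<union> W) a \<le>
    C * exit_moment P B p V a + l * (c * exit_prob P B V (frontier V \<inter> W) a)"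
proof -
  interpret planar_bm "P a" B a by unfold_locales (rule bm)
  let ?S = "frontier V \<inter> W" and ?U = "V \<union> W"
  let ?T = "\<lambda>\<omega>. exit_time V (\<lambda>t. B t \<omega>)"
  have "?S \<in> sets borel"
    using W frontier_closed by (intro sets.Int borel_closed borel_open) auto
  moreover have "open ?U" using V W by blast
  moreover have "(\<integral>\<^sup>+ z. truncated_powr p K (exit_functional ?U (\<lambda>i. b + z i)) \<partial>distr (P a) path_space (future B 0)) \<le> c"
    if "b \<in> ?S" for b
  proof -
    \<comment> \<open>\<open>c\<close> bounds moments under \<open>P b\<close>; equality of the laws
      of \<open>future B 0\<close> carries the bound over to \<open>P a\<close>.\<close>
    interpret b: planar_bm "P b" B b by unfold_locales (rule bm)
    have "distr (P a) path_space (future B 0) = distr (P b) path_space (future B 0)"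
      using distr_future_eq[OF bm bm, of a "(0, 0)" b "(0, 0)"] by (simp add: dyadic_def)
    then show ?thesis
      using c[OF that] b.nn_integral_truncated_exit_time[OF \<open>open ?U\<close> p, of K]
      by (simp add: truncated_moment_def)
  qed
  ultimately obtain h where h: "h \<in> borel_measurable (P a)"
    "AE \<omega> in P a. ?T \<omega> < \<infinity> \<longrightarrow> B (enn2real (?T \<omega>)) \<omega> \<in> ?S \<longrightarrow>
       truncated_powr p K (exit_time ?U (\<lambda>v. B (enn2real (?T \<omega>) + v) \<omega>)) \<le> h \<omega>"
    "(\<integral>\<^sup>+ \<omega>. h \<omega> \<partial>P a) \<le> c * emeasure (P a) {\<omega> \<in> space (P a). ?T \<omega> < \<infinity> \<and> B (enn2real (?T \<omega>)) \<omega> \<in> ?S}"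
    using strong_markov_bound[OF V _ _ p, of ?U ?S K c] by blast
  have "(\<lambda>T. SUP n. truncated_powr p (real n) T) \<in> borel_measurable borel"
    using measurable_truncated_powr[OF p] by measurable
  then have "(\<lambda>T. ennreal_powr T p) \<in> borel_measurable borel"
    by (simp add: SUP_truncated_powr[OF p])
  then have [measurable]: "(\<lambda>\<omega>. ennreal_powr (?T \<omega>) p) \<in> borel_measurable (P a)"
    by (rule measurable_compose[OF measurable_exit_time[OF V]])
  have "truncated_moment P B p K ?U a \<le> (\<integral>\<^sup>+ \<omega>. C * ennreal_powr (?T \<omega>) p + l * h \<omega> \<partial>P a)"
    unfolding truncated_moment_def
  proof (rule nn_integral_mono_AE, use h(2) AE_start AE_space in eventually_elim)
    case (elim \<omega>)
    let ?R = "if ?T \<omega> < \<infinity> \<and> B (enn2real (?T \<omega>)) \<omega> \<in> ?S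
      then exit_time ?U (\<lambda>v. B (enn2real (?T \<omega>) + v) \<omega>) else 0"
    have "exit_time ?U (\<lambda>t. B t \<omega>) \<le> ?T \<omega> + ?R"
      using exit_time_union_le[OF V W continuous_B[OF elim(3)]] a elim(2) by simp
    then have "truncated_powr p K (exit_time ?U (\<lambda>t. B t \<omega>)) \<le>
        C * ennreal_powr (?T \<omega>) p + l * truncated_powr p K ?R"
      by (rule C[OF K])
    \<comment> \<open>Without an exit through \<open>?S\<close> the second leg is 0, and so is its
      truncated power.\<close>
    also have "truncated_powr p K ?R \<le> h \<omega>"
      using elim(1) K p by (auto simp: truncated_powr_def)
    finally show ?case by (meson add_left_mono mult_left_mono order_trans zero_le)
  qed
  also have "\<dots> = C * exit_moment P B p V a + l * (\<integral>\<^sup>+ \<omega>. h \<omega> \<partial>P a)"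
    using h(1) by (simp add: nn_integral_add nn_integral_cmult exit_moment_def)
  also have "\<dots> \<le> C * exit_moment P B p V a + l * (c * exit_prob P B V ?S a)"
    using h(3) by (intro add_left_mono mult_left_mono) (auto simp: exit_prob_def)
  finally show ?thesis .
qed

lemma truncated_moment_le:
  assumes "planar_brownian_motion (P a) B a" "0 < p" "0 \<le> K"
  shows "truncated_moment P B p K U a \<le> ennreal (K powr p)"
proof -
  interpret planar_bm "P a" B a by unfold_locales fact
  have "truncated_moment P B p K U a \<le> (\<integral>\<^sup>+ \<omega>. ennreal (K powr p) \<partial>P a)"
    unfolding truncated_moment_def by (intro nn_integral_mono truncated_powr_le assms)
  then show ?thesis by (simp add: emeasure_space_1)
qed

lemma SUP_truncated_moment:
  assumes bm: "planar_brownian_motion (P a) B a" and p: "0 < p" and U: "open U"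
  shows "exit_moment P B p U a = (SUP n. truncated_moment P B p (real n) U a)"
proof -
  interpret planar_bm "P a" B a by unfold_locales fact
  have "incseq (\<lambda>n \<omega>. truncated_powr p (real n) (exit_time U (\<lambda>t. B t \<omega>)))"
    unfolding truncated_powr_def using p
    by (intro incseq_SucI le_funI ennreal_leI powr_mono2 enn2real_mono min.mono)
       (auto simp: min_less_iff_disj ennreal_leI)
  then have "(\<integral>\<^sup>+ \<omega>. (SUP n. truncated_powr p (real n) (exit_time U (\<lambda>t. B t \<omega>))) \<partial>P a) =
      (SUP n. truncated_moment P B p (real n) U a)"
    unfolding truncated_moment_def
    by (intro nn_integral_monotone_convergence_SUP measurable_compose[OF measurable_exit_time[OF U]]
        measurable_truncated_powr p)
  then show ?thesis
    by (simp add: SUP_truncated_powr[OF p] exit_moment_def)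
qed

text \<open>Inserting the bound for \<open>y\<close> gives \<open>x \<le> \<alpha> + l * \<theta> *
  \<beta> + l * l * \<theta> * x\<close>. Moving the last term to the left requires a finite
  \<open>x\<close>, hence the passage to real numbers.\<close>

lemma two_step_bound:
  fixes x y :: ennreal
  assumes fin: "x < \<infinity>" "y < \<infinity>" and \<theta>: "0 \<le> \<theta>" "l\<^sup>2 * \<theta> < 1" and nn: "0 \<le> \<alpha>" "0 \<le> \<beta>" "0 \<le> l"
    and x: "x \<le> ennreal \<alpha> + ennreal l * (y * ennreal \<theta>)"
    and y: "y \<le> ennreal \<beta> + ennreal l * x"
  shows "x \<le> ennreal ((\<alpha> + l * \<theta> * \<beta>) / (1 - l\<^sup>2 * \<theta>))"
proof -
  obtain r s where r: "x = ennreal r" "0 \<le> r" and s: "y = ennreal s" "0 \<le> s"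
    using fin by (metis enn2real_nonneg ennreal_enn2real infinity_ennreal_def)
  have "ennreal r \<le> ennreal (\<alpha> + l * (s * \<theta>))" "ennreal s \<le> ennreal (\<beta> + l * r)"
    using x y r s nn \<theta> by (simp_all add: ennreal_mult)
  then have "r \<le> \<alpha> + l * (s * \<theta>)" "s \<le> \<beta> + l * r"
    by (auto elim!: ennreal_le_iff[THEN iffD1, rotated] simp del: ennreal_plus intro!: add_nonneg_nonneg mult_nonneg_nonneg r s nn \<theta>)
  moreover from this(2) have "l * (s * \<theta>) \<le> l * ((\<beta> + l * r) * \<theta>)"
    using nn \<theta> by (intro mult_left_mono mult_right_mono)
  ultimately have "r * (1 - l\<^sup>2 * \<theta>) \<le> \<alpha> + l * \<theta> * \<beta>"
    by (simp add: algebra_simps power2_eq_square)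
  then show ?thesis
    using \<theta> r by (auto intro!: ennreal_leI simp: pos_le_divide_eq)
qed

theorem theorem3:
  fixes P :: "complex \<Rightarrow> 'w measure"
    and B :: "real \<Rightarrow> 'w \<Rightarrow> complex"
    and p :: real
    and V W :: "complex set"
  assumes "\<And>a. planar_brownian_motion (P a) B a"
    and "p > 0"
    and "domain V" and "domain W"
    and "V \<inter> W \<noteq> {}"
    and "\<not> V \<subseteq> W" and "\<not> W \<subseteq> V"
    and "finite_exit_moment P B p V"
    and "finite_exit_moment P B p W"
    and "(SUP a \<in> frontier V \<inter> W. exit_moment P B p W a) < \<infinity>"
    and "(SUP a \<in> frontier W \<inter> V. exit_moment P B p V a) < \<infinity>"
    and "(SUP a \<in> frontier V \<inter> W. exit_prob P B W (frontier W \<inter> V) a) < 1"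
  shows "finite_exit_moment P B p (V \<union> W)"
proof -
  note bm = assms(1) and p = assms(2)
  have V: "open V" and W: "open W"
    using assms(3,4) by (simp_all add: domain_def)
  let ?U = "V \<union> W" and ?SV = "frontier V \<inter> W" and ?SW = "frontier W \<inter> V"
  \<comment> \<open>If \<open>?SV\<close> is empty the supremum in \<open>ennreal\<close> is 0, so
    no separate case arises.\<close>
  define \<theta> where "\<theta> = enn2real (SUP a\<in>?SV. exit_prob P B W ?SW a)"
  have SUP_prob: "(SUP a\<in>?SV. exit_prob P B W ?SW a) = ennreal \<theta>"
    unfolding \<theta>_def using order_less_trans[OF assms(12)] by simp
  have \<theta>: "0 \<le> \<theta>" "\<theta> < 1"
    using assms(12) unfolding SUP_prob by (simp_all add: \<theta>_def)
  \<comment> \<open>This makes \<open>l * l * \<theta>\<close> equal to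
    \<open>2 * \<theta> / (1 + \<theta>)\<close>; both this being below 1 and \<open>1 < l\<close>
    follow from \<open>\<theta> < 1\<close>.\<close>
  define l where "l = sqrt (2 / (1 + \<theta>))"
  have l: "1 < l" "l\<^sup>2 * \<theta> < 1"
    using \<theta> by (simp_all add: l_def field_simps)
  obtain C where C: "0 < C" "\<And>K A T R. 0 \<le> K \<Longrightarrow> A \<le> T + R \<Longrightarrow>
      truncated_powr p K A \<le> ennreal C * ennreal_powr T p + ennreal l * truncated_powr p K R"
    using truncated_powr_add_le[OF p l(1)] by metis
  obtain mW where mW: "(SUP a\<in>?SV. exit_moment P B p W a) = ennreal mW" "0 \<le> mW"
    using assms(10) by (metis enn2real_nonneg ennreal_enn2real infinity_ennreal_def)
  obtain mV where mV: "(SUP a\<in>?SW. exit_moment P B p V a) = ennreal mV" "0 \<le> mV"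
    using assms(11) by (metis enn2real_nonneg ennreal_enn2real infinity_ennreal_def)
  have prob_le: "exit_prob P B D S a \<le> 1" for D S a
  proof -
    interpret planar_bm "P a" B a by unfold_locales (rule bm)
    show ?thesis unfolding exit_prob_def by (rule emeasure_le_1)
  qed
  define mu where "mu K a = truncated_moment P B p K ?U a" for K a
  define x where "x K = (SUP b\<in>?SV. mu K b)" for K
  define y where "y K = (SUP b\<in>?SW. mu K b)" for K
  have stepV: "mu K a \<le> ennreal C * exit_moment P B p V a + ennreal l * (x K * exit_prob P B V ?SV a)"
    if "a \<in> V" "0 \<le> K" for a K
    unfolding mu_def using that
    by (intro truncated_moment_step bm p V W C(2)) (auto simp: x_def mu_def intro: SUP_upper)
  have stepW: "mu K a \<le> ennreal C * exit_moment P B p W a + ennreal l * (y K * exit_prob P B W ?SW a)"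
    if "a \<in> W" "0 \<le> K" for a K
    unfolding mu_def Un_commute[of V W] using that
    by (intro truncated_moment_step bm p V W C(2)) (auto simp: y_def mu_def Un_commute[of V W] intro: SUP_upper)
  \<comment> \<open>Here the exit probability is bounded by 1. A contraction is available only for
    exits from \<open>W\<close> started in \<open>?SV\<close>, and one such factor per round trip
    suffices.\<close>
  have stepV': "mu K a \<le> ennreal C * exit_moment P B p V a + ennreal l * x K"
    if "a \<in> V" "0 \<le> K" for a K
    by (rule order_trans[OF stepV[OF that]])
       (metis add_left_mono mult.right_neutral mult_left_mono prob_le zero_le)
  have stepW': "mu K a \<le> ennreal C * exit_moment P B p W a + ennreal l * y K"
    if "a \<in> W" "0 \<le> K" for a K
    by (rule order_trans[OF stepW[OF that]])
       (metis add_left_mono mult.right_neutral mult_left_mono prob_le zero_le)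
  have x_le: "x K \<le> ennreal (C * mW) + ennreal l * (y K * ennreal \<theta>)" if K: "0 \<le> K" for K
    unfolding x_def
  proof (rule SUP_least)
    fix b assume b: "b \<in> ?SV"
    have "mu K b \<le> ennreal C * exit_moment P B p W b + ennreal l * (y K * exit_prob P B W ?SW b)"
      using stepW b K by blast
    also have "\<dots> \<le> ennreal C * ennreal mW + ennreal l * (y K * ennreal \<theta>)"
      unfolding mW(1)[symmetric] SUP_prob[symmetric] using b
      by (intro add_mono mult_left_mono SUP_upper) auto
    finally show "mu K b \<le> ennreal (C * mW) + ennreal l * (y K * ennreal \<theta>)"
      using C(1) mW(2) by (simp add: ennreal_mult)
  qed
  have y_le: "y K \<le> ennreal (C * mV) + ennreal l * x K" if K: "0 \<le> K" for K
    unfolding y_def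
  proof (rule SUP_least)
    fix b assume b: "b \<in> ?SW"
    have "mu K b \<le> ennreal C * exit_moment P B p V b + ennreal l * x K"
      using stepV' b K by blast
    also have "\<dots> \<le> ennreal C * ennreal mV + ennreal l * x K"
      unfolding mV(1)[symmetric] using b
      by (intro add_mono mult_left_mono SUP_upper) auto
    finally show "mu K b \<le> ennreal (C * mV) + ennreal l * x K"
      using C(1) mV(2) by (simp add: ennreal_mult)
  qed
  define R where "R = (C * mW + l * \<theta> * (C * mV)) / (1 - l\<^sup>2 * \<theta>)"
  have x_bound: "x K \<le> ennreal R" if K: "0 \<le> K" for K
    unfolding R_def
  proof (rule two_step_bound)
    \<comment> \<open>This crude bound grows with \<open>K\<close> and serves only for finiteness;
      it does not enter \<open>R\<close>.\<close>
    have "mu K b \<le> ennreal (K powr p)" for b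
      unfolding mu_def by (rule truncated_moment_le[OF bm p K])
    then have "x K \<le> ennreal (K powr p)" "y K \<le> ennreal (K powr p)"
      by (auto simp: x_def y_def intro: SUP_least)
    then show "x K < \<infinity>" "y K < \<infinity>"
      by (auto intro: order_le_less_trans)
  qed (use K x_le y_le C(1) mW mV l \<theta> in auto)
  have y_bound: "y K \<le> ennreal (C * mV) + ennreal l * ennreal R" if K: "0 \<le> K" for K
    using y_le[OF K] x_bound[OF K] by (meson add_left_mono mult_left_mono order_trans zero_le)
  \<comment> \<open>A bound uniform in \<open>K\<close> passes to the supremum over the truncations,
    which is the full moment.\<close>
  have fin: "exit_moment P B p ?U a < \<infinity>"
    if b: "\<And>K. 0 \<le> K \<Longrightarrow> mu K a \<le> b" and b': "b < \<infinity>" for a b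
  proof -
    have "exit_moment P B p ?U a \<le> b"
      unfolding SUP_truncated_moment[of P a B, OF bm p open_Un[OF V W]]
      using b by (intro SUP_least) (simp add: mu_def)
    then show ?thesis using b' by (rule order_le_less_trans)
  qed
  show ?thesis
    unfolding finite_exit_moment_def
  proof
    fix a assume "a \<in> ?U"
    then show "exit_moment P B p ?U a < \<infinity>"
    proof
      assume a: "a \<in> V"
      show ?thesis
      proof (rule fin)
        show "mu K a \<le> ennreal C * exit_moment P B p V a + ennreal l * ennreal R" if "0 \<le> K" for K
          using stepV'[OF a that] x_bound[OF that] by (meson add_left_mono mult_left_mono order_trans zero_le)
        show "ennreal C * exit_moment P B p V a + ennreal l * ennreal R < \<infinity>"
          using assms(8) a by (auto simp: finite_exit_moment_def ennreal_mult_less_top)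
      qed
    next
      assume a: "a \<in> W"
      show ?thesis
      proof (rule fin)
        \<comment> \<open>From \<open>W\<close> a first leg that does not leave the union ends in
          \<open>?SW\<close>, so the uniform bound on \<open>y\<close> enters, itself derived from
          that on \<open>x\<close>.\<close>
        show "mu K a \<le> ennreal C * exit_moment P B p W a +
            ennreal l * (ennreal (C * mV) + ennreal l * ennreal R)" if "0 \<le> K" for K
          using stepW'[OF a that] y_bound[OF that] by (meson add_left_mono mult_left_mono order_trans zero_le)
        show "ennreal C * exit_moment P B p W a +
            ennreal l * (ennreal (C * mV) + ennreal l * ennreal R) < \<infinity>"
          using assms(9) a by (auto simp: finite_exit_moment_def ennreal_mult_less_top)
      qed
    qed
  qed
qed

end
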